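(* Suppose that $X$ is a countable linear order. Then $X$ is left-absorbing if and only if there is a countable, minimal collection $\{I_k\}$ of non-empty countable linear orders, and two countable orders $L$ and $R$, such that $X = L + \mathbb{Q}[I_k] + R$ and exactly one of the following eight conditions holds: (1) $L = R = \emptyset$; (2) there is an index $k$ such that $L \cong I_k$, and $R = \emptyset$; (3) there is an index $k$ such that $R \cong I_k$, and $L = \emptyset$; (4) there are indices $k_1, k_2$ such that $L \cong I_{k_1}$ and $R \cong I_{k_2}$, but there is no index $k$ such that $R + L \cong I_k$; (5) there is an index $k_0$ such that $R + L \cong I_{k_0}$, but no index $k$ such that $L \cong I_k$ and no index $k$ such that $R \cong I_k$; (6) there is an index $k_0$ such that $R + L \cong I_{k_0}$ and an index $k_1$ such that $L \cong I_{k_1}$, but no index $k$ such that $R \cong I_k$; (7) there is an index $k_0$ such that $R + L \cong I_{k_0}$ and an index $k_1$ such that $R \cong I_{k_1}$, but no index $k$ such that $L \cong I_k$; (8) there are indices $k_0, k_1, k_2$ such that $R + L \cong I_{k_0}$, $L \cong I_{k_1}$, and $R \cong I_{k_2}$. Moreover, suppose that $X$ is left-absorbing (represented as $X = L + \mathbb{Q}[I_k] + R$ as just described) and $A$ is a countable order. Whether $AX \cong X$ is determined by which of the eight conditions (1)–(8) $X$ satisfies, as follows: (i) if (1), then $AX \cong X$ for every countable order $A$; (ii) if (2), then $AX \cong X$ iff $A$ has a left endpoint; (iii) if (3), then $AX \cong X$ iff $A$ has a right endpoint; (iv) if (4), then $AX \cong X$ iff $A \cong 1 + \mathbb{Q}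 + 1$ or $A \cong 1$; (v) if (5), then $AX \cong X$ iff $A$ has a left and right endpoint, every point of $A$ other than the right endpoint has a successor, and every point of $A$ other than the left endpoint has a predecessor; (vi) if (6), then $AX \cong X$ iff $A$ has a left and right endpoint and every point of $A$ other than the right endpoint has a successor; (vii) if (7), then $AX \cong X$ iff $A$ has a left and right endpoint and every point of $A$ other than the left endpoint has a predecessor; (viii) if (8), then $AX \cong X$ iff $A$ has a left and right endpoint.
   Context: All orders are linear orders; $AX$ denotes the lexicographic product (replace each point of $A$ by a copy of $X$). An order $X$ is left-absorbing if there is an order $A$ with at least two points such that $AX \cong X$. $Y + Z$ denotes the ordered sum. For $N$ either a natural number $n \geq 1$ or $\mathbb{N}$, a shuffle $\mathbb{Q}[I_k]$ of orders $\{I_k\}_{k \in N}$ is obtained by partitioning $\mathbb{Q} = \bigcup_{k\in N} Q_k$ into subsets each dense in $\mathbb{Q}$ and replacing each $q \in Q_k$ by a copy of $I_k$ (unique up to isomorphism). A convex copy of an order $Y$ inside an order is an interval isomorphic to $Y$. A countable collection $\{I_k\}$ of countable orders is minimal if none of the $I_k$ contains a convex copy of the shuffle $\mathbb{Q}[I_k]$. $1$ denotes the one-point order.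
   Formalization: X is assumed non-empty, A non-empty in (i), R non-empty in (6) and L non-empty in (7): literally (2) implies (6) and (3) implies (7), so "exactly one" fails for X = 1 + Q. In the first equivalence the I_k, L, R are orders on sets of natural numbers. *)

theory Defs
  imports Complex_Main "HOL-Library.Countable_Set"
begin

text \<open>
  A linear order is a reflexive relation \<^term>\<open>r\<close> with \<^term>\<open>Linear_order r\<close>, carried by
  \<^term>\<open>Field r\<close>; the empty order is \<^term>\<open>{}\<close>.
\<close>

definition order_isomorphic :: "'a rel \<Rightarrow> 'b rel \<Rightarrow> bool" (infix "\<cong>" 50) where
  "r \<cong> s \<longleftrightarrow> (\<exists>f. iso r s f)"

definition countable_order :: "'a rel \<Rightarrow> bool" where
  "countable_order r \<longleftrightarrow> Linear_order r \<and> countable (Field r)"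

definition order_sum :: "'a rel \<Rightarrow> 'b rel \<Rightarrow> ('a + 'b) rel" (infixr "\<^bold>+" 65) where
  "r \<^bold>+ s = map_prod Inl Inl ` r \<union> map_prod Inr Inr ` s \<union> (Inl ` Field r) \<times> (Inr ` Field s)"

text \<open>Each point \<open>a\<close> of the index order is replaced by a copy of \<open>J a\<close>.\<close>

definition replace_points :: "'i rel \<Rightarrow> ('i \<Rightarrow> 'a rel) \<Rightarrow> ('i \<times> 'a) rel" where
  "replace_points r J =
     {((a, x), (b, y)). a \<in> Field r \<and> b \<in> Field r \<and> x \<in> Field (J a) \<and> y \<in> Field (J b) \<and>
        ((a \<noteq> b \<and> (a, b) \<in> r) \<or> (a = b \<and> (x, y) \<in> J a))}"

definition lex_product :: "'a rel \<Rightarrow> 'b rel \<Rightarrow> ('a \<times> 'b) rel" (infixr "\<^bold>*" 70) where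
  "A \<^bold>* X = replace_points A (\<lambda>_. X)"

text \<open>
  The order \<open>A\<close> ranges over orders on the type of \<open>X\<close>.  For non-empty \<open>X\<close> this loses nothing,
  since \<open>A\<close> embeds into \<open>A \<^bold>* X \<cong> X\<close>; see \<open>left_absorbingI\<close> below.
\<close>

definition left_absorbing :: "'a rel \<Rightarrow> bool" where
  "left_absorbing X \<longleftrightarrow>
     (\<exists>A :: 'a rel. Linear_order A \<and> (\<exists>a\<in>Field A. \<exists>b\<in>Field A. a \<noteq> b) \<and> A \<^bold>* X \<cong> X)"

lemma left_absorbingI:
  fixes A :: "'b rel" and X :: "'a rel"
  assumes "Linear_order A" and "a \<in> Field A" "b \<in> Field A" "a \<noteq> b"
    and "A \<^bold>* X \<cong> X" and "Linear_order X" and "X \<noteq> {}"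
  shows "left_absorbing X"
proof -
  obtain x0 where x0: "x0 \<in> Field X"
    using \<open>X \<noteq> {}\<close> by (auto simp: Field_def)
  have refl: "(x, x) \<in> X" if "x \<in> Field X" for x
    using that assms(6) by (auto simp: order_on_defs refl_on_def)
  have reflA: "(x, x) \<in> A" if "x \<in> Field A" for x
    using that assms(1) by (auto simp: order_on_defs refl_on_def)
  have fld: "Field (B \<^bold>* X) = Field B \<times> Field X" for B :: "'c rel"
    using refl by (fastforce simp: Field_def lex_product_def replace_points_def)
  obtain f where f: "iso (A \<^bold>* X) X f"
    using assms(5) by (auto simp: order_isomorphic_def)
  then have bij: "bij_betw f (Field A \<times> Field X) (Field X)"
    and ord: "\<And>p q. p \<in> Field A \<times> Field X \<Longrightarrow> q \<in> Field A \<times> Field X \<Longrightarrow>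
                (p, q) \<in> A \<^bold>* X \<longleftrightarrow> (f p, f q) \<in> X"
    by (auto simp: iso_iff2 fld)
  define g where "g = (\<lambda>a. f (a, x0))"
  have inj: "inj_on g (Field A)"
    using bij x0 by (auto simp: g_def inj_on_def bij_betw_def)
  define B where "B = dir_image A g"
  have linB: "Linear_order B"
    unfolding B_def by (rule Linear_order_dir_image[OF assms(1) inj])
  have fldB: "Field B = g ` Field A"
    unfolding B_def by (rule dir_image_Field)
  have B_iff: "(g x, g y) \<in> B \<longleftrightarrow> (x, y) \<in> A" if "x \<in> Field A" "y \<in> Field A" for x y
  proof
    assume "(g x, g y) \<in> B"
    then obtain u v where uv: "(u, v) \<in> A" "g x = g u" "g y = g v"
      by (auto simp: B_def dir_image_def)
    then have "u \<in> Field A" "v \<in> Field A" by (auto simp: Field_def)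
    with uv inj that show "(x, y) \<in> A" by (metis inj_onD)
  next
    assume "(x, y) \<in> A" then show "(g x, g y) \<in> B" by (auto simp: B_def dir_image_def)
  qed
  define h where "h = inv_into (Field A) g"
  have h: "h (g x) = x" if "x \<in> Field A" for x
    using inj that by (simp add: h_def)
  have bij1: "bij_betw (map_prod h id) (Field B \<times> Field X) (Field A \<times> Field X)"
    by (rule bij_betw_byWitness[where f' = "map_prod g id"]) (auto simp: fldB h)
  have "iso (B \<^bold>* X) X (f \<circ> map_prod h id)"
    unfolding iso_iff2 fld
  proof (intro conjI ballI)
    show "bij_betw (f \<circ> map_prod h id) (Field B \<times> Field X) (Field X)"
      using bij1 bij by (rule bij_betw_trans)
  next
    fix p q assume p: "p \<in> Field B \<times> Field X" and q: "q \<in> Field B \<times> Field X"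
    obtain u x where p': "p = (g u, x)" "u \<in> Field A" "x \<in> Field X" using p fldB by auto
    obtain v y where q': "q = (g v, y)" "v \<in> Field A" "y \<in> Field X" using q fldB by auto
    have "g u = g v \<longleftrightarrow> u = v" using inj p' q' by (auto simp: inj_on_def)
    then have "(p, q) \<in> B \<^bold>* X \<longleftrightarrow> ((u, x), (v, y)) \<in> A \<^bold>* X"
      using p' q' B_iff by (auto simp: lex_product_def replace_points_def fldB)
    also have "\<dots> \<longleftrightarrow> (f (u, x), f (v, y)) \<in> X"
      using p' q' by (intro ord) auto
    finally show "(p, q) \<in> B \<^bold>* X \<longleftrightarrow> ((f \<circ> map_prod h id) p, (f \<circ> map_prod h id) q) \<in> X"
      using p' q' h by simp
  qed
  moreover have "g a \<noteq> g b" "g a \<in> Field B" "g b \<in> Field B"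
    using inj assms(2-4) by (auto simp: inj_on_def fldB)
  ultimately show ?thesis
    using linB unfolding left_absorbing_def order_isomorphic_def by blast
qed

definition order_one :: "unit rel" ("\<^bold>1") where
  "\<^bold>1 = {((), ())}"

definition order_rat :: "rat rel" ("\<^bold>Q") where
  "\<^bold>Q = {(p, q). p \<le> q}"

text \<open>The index sets \<open>n \<ge> 1\<close> (as \<open>{0, \<dots>, n - 1}\<close>) and \<open>\<nat>\<close> of a countable collection.\<close>

definition index_set :: "nat set \<Rightarrow> bool" where
  "index_set N \<longleftrightarrow> (\<exists>n\<ge>1. N = {..<n}) \<or> N = UNIV"

text \<open>The partition of the rationals is given by its colouring \<open>c\<close>, that is \<open>Q\<^sub>k = c -` {k}\<close>.\<close>

definition dense_partition :: "nat set \<Rightarrow> (rat \<Rightarrow> nat) \<Rightarrow> bool" where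
  "dense_partition N c \<longleftrightarrow>
     range c \<subseteq> N \<and> (\<forall>k\<in>N. \<forall>a b. a < b \<longrightarrow> (\<exists>q. a < q \<and> q < b \<and> c q = k))"

lemma dense_partition_exists:
  assumes "index_set N"
  shows "\<exists>c. dense_partition N c"
proof -
  define P where "P = (\<lambda>(q::rat) j. \<exists>(m::int) (n::int). odd n \<and> q * (2 ^ j * of_int n) = of_int m)"
  define d where "d = (\<lambda>q. LEAST j. P q j)"
  have d_dense: "\<exists>q. a < q \<and> q < b \<and> d q = k" if "a < b" for a b :: rat and k
  proof -
    obtain t :: nat where t: "2 / (b - a) < of_nat t"
      using reals_Archimedean2 by blast
    define n :: int where "n = 2 * int t + 1"
    define D :: rat where "D = 2 ^ k * of_int n"
    have n: "odd n" "n > 0" by (auto simp: n_def)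
    have nt: "of_nat t < (of_int n :: rat)" by (simp add: n_def)
    have "D \<ge> 1 * of_int n"
      unfolding D_def using n by (intro mult_right_mono) auto
    then have Dt: "2 / (b - a) < D" using t nt by linarith
    then have D0: "D > 0" using that by (smt (verit) diff_gt_0_iff_gt divide_pos_pos less_trans zero_less_numeral)
    have gap: "2 < (b - a) * D" using Dt that by (simp add: field_simps)
    define m :: int where "m = 2 * \<lfloor>(a * D + 1) / 2\<rfloor> + 1"
    have m: "a * D < of_int m" "of_int m \<le> a * D + 2"
      using floor_correct[of "(a * D + 1) / 2"] by (simp_all add: m_def field_simps)
    have mb: "of_int m < b * D" using m gap by (simp add: algebra_simps)
    define q where "q = of_int m / D"
    have ab: "a < q" "q < b" using m mb D0 by (auto simp: q_def field_simps)
    have qD: "q * (2 ^ k * of_int n) = of_int m" using n by (simp add: q_def D_def)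
    have "d q = k"
      unfolding d_def
    proof (rule Least_equality)
      show "P q k" unfolding P_def using n qD by blast
    next
      fix j assume "P q j"
      then obtain m' n' where j: "odd n'" "q * (2 ^ j * of_int n') = of_int m'"
        unfolding P_def by blast
      show "k \<le> j"
      proof (rule ccontr)
        assume "\<not> k \<le> j"
        then obtain i where i: "k = j + Suc i" by (metis less_iff_Suc_add not_le add_Suc_right)
        have "of_int (m * n') = q * (2 ^ k * of_int n) * of_int n'" using qD by simp
        also have "\<dots> = q * (2 ^ j * of_int n') * (2 ^ Suc i * of_int n)"
          by (simp add: i power_add algebra_simps)
        also have "\<dots> = of_int (m' * (2 ^ Suc i * n))" using j by simp
        finally have "m * n' = m' * (2 ^ Suc i * n)" by (simp only: of_int_eq_iff)
        moreover have "odd (m * n')" using j by (simp add: m_def)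
        ultimately show False by simp
      qed
    qed
    with ab show ?thesis by blast
  qed
  show ?thesis
  proof (cases "N = UNIV")
    case True
    then show ?thesis using d_dense by (intro exI[of _ d]) (simp add: dense_partition_def)
  next
    case False
    then obtain n where n: "n \<ge> 1" "N = {..<n}" using assms by (auto simp: index_set_def)
    have "dense_partition N (\<lambda>q. if d q < n then d q else 0)"
      unfolding dense_partition_def
    proof (intro conjI ballI allI impI)
      show "range (\<lambda>q. if d q < n then d q else 0) \<subseteq> N" using n by auto
    next
      fix k a b assume "k \<in> N" "(a :: rat) < b"
      then obtain q where "a < q" "q < b" "d q = k" using d_dense by blast
      then show "\<exists>q>a. q < b \<and> (if d q < n then d q else 0) = k"
        using \<open>k \<in> N\<close> n by (intro exI[of _ q]) auto
    qed
    then show ?thesis by blast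
  qed
qed

text \<open>
  The shuffle does not depend, up to isomorphism, on the partition, so an arbitrary one is chosen.
\<close>

definition shuffle :: "nat set \<Rightarrow> (nat \<Rightarrow> 'a rel) \<Rightarrow> (rat \<times> 'a) rel" where
  "shuffle N I = (let c = (SOME c. dense_partition N c) in replace_points \<^bold>Q (\<lambda>q. I (c q)))"

definition has_convex_copy :: "'a rel \<Rightarrow> 'b rel \<Rightarrow> bool" where
  "has_convex_copy Z Y \<longleftrightarrow>
     (\<exists>S\<subseteq>Field Z. (\<forall>x\<in>S. \<forall>y\<in>S. \<forall>z. (x, z) \<in> Z \<and> (z, y) \<in> Z \<longrightarrow> z \<in> S) \<and> Y \<cong> Restr Z S)"

definition minimal_collection :: "nat set \<Rightarrow> (nat \<Rightarrow> 'a rel) \<Rightarrow> bool" where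
  "minimal_collection N I \<longleftrightarrow> (\<forall>k\<in>N. \<not> has_convex_copy (I k) (shuffle N I))"

definition shuffle_representation ::
    "'x rel \<Rightarrow> nat set \<Rightarrow> (nat \<Rightarrow> 'i rel) \<Rightarrow> 'l rel \<Rightarrow> 'r rel \<Rightarrow> bool" where
  "shuffle_representation X N I L R \<longleftrightarrow>
     index_set N \<and> (\<forall>k\<in>N. countable_order (I k) \<and> I k \<noteq> {}) \<and> minimal_collection N I \<and>
     countable_order L \<and> countable_order R \<and> X \<cong> L \<^bold>+ shuffle N I \<^bold>+ R"

datatype end_type = C1 | C2 | C3 | C4 | C5 | C6 | C7 | C8

text \<open>
  The clauses \<open>R \<noteq> {}\<close> in \<open>C6\<close> and \<open>L \<noteq> {}\<close> in \<open>C7\<close> keep these conditions apart from \<open>C2\<close> and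
  \<open>C3\<close>: if \<open>R\<close> is empty then \<open>R \<^bold>+ L \<cong> L\<close>, and \<open>R\<close> is isomorphic to no (non-empty) \<open>I k\<close>.
  In \<open>C4\<close>, \<open>C5\<close> and \<open>C8\<close> both \<open>L\<close> and \<open>R\<close> are automatically non-empty.
\<close>

primrec end_condition ::
    "end_type \<Rightarrow> nat set \<Rightarrow> (nat \<Rightarrow> 'i rel) \<Rightarrow> 'l rel \<Rightarrow> 'r rel \<Rightarrow> bool" where
  "end_condition C1 N I L R \<longleftrightarrow> L = {} \<and> R = {}"
| "end_condition C2 N I L R \<longleftrightarrow> (\<exists>k\<in>N. L \<cong> I k) \<and> R = {}"
| "end_condition C3 N I L R \<longleftrightarrow> (\<exists>k\<in>N. R \<cong> I k) \<and> L = {}"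
| "end_condition C4 N I L R \<longleftrightarrow>
     (\<exists>k\<^sub>1\<in>N. \<exists>k\<^sub>2\<in>N. L \<cong> I k\<^sub>1 \<and> R \<cong> I k\<^sub>2) \<and> \<not> (\<exists>k\<in>N. R \<^bold>+ L \<cong> I k)"
| "end_condition C5 N I L R \<longleftrightarrow>
     (\<exists>k\<^sub>0\<in>N. R \<^bold>+ L \<cong> I k\<^sub>0) \<and> \<not> (\<exists>k\<in>N. L \<cong> I k) \<and> \<not> (\<exists>k\<in>N. R \<cong> I k)"
| "end_condition C6 N I L R \<longleftrightarrow>
     (\<exists>k\<^sub>0\<in>N. R \<^bold>+ L \<cong> I k\<^sub>0) \<and> (\<exists>k\<^sub>1\<in>N. L \<cong> I k\<^sub>1) \<and> \<not> (\<exists>k\<in>N. R \<cong> I k) \<and> R \<noteq> {}"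
| "end_condition C7 N I L R \<longleftrightarrow>
     (\<exists>k\<^sub>0\<in>N. R \<^bold>+ L \<cong> I k\<^sub>0) \<and> (\<exists>k\<^sub>1\<in>N. R \<cong> I k\<^sub>1) \<and> \<not> (\<exists>k\<in>N. L \<cong> I k) \<and> L \<noteq> {}"
| "end_condition C8 N I L R \<longleftrightarrow>
     (\<exists>k\<^sub>0\<in>N. \<exists>k\<^sub>1\<in>N. \<exists>k\<^sub>2\<in>N. R \<^bold>+ L \<cong> I k\<^sub>0 \<and> L \<cong> I k\<^sub>1 \<and> R \<cong> I k\<^sub>2)"

definition is_left_endpoint :: "'a rel \<Rightarrow> 'a \<Rightarrow> bool" where
  "is_left_endpoint A a \<longleftrightarrow> a \<in> Field A \<and> (\<forall>b\<in>Field A. (a, b) \<in> A)"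

definition is_right_endpoint :: "'a rel \<Rightarrow> 'a \<Rightarrow> bool" where
  "is_right_endpoint A a \<longleftrightarrow> a \<in> Field A \<and> (\<forall>b\<in>Field A. (b, a) \<in> A)"

definition is_successor :: "'a rel \<Rightarrow> 'a \<Rightarrow> 'a \<Rightarrow> bool" where
  "is_successor A a b \<longleftrightarrow>
     (a, b) \<in> A \<and> a \<noteq> b \<and> (\<forall>z. (a, z) \<in> A \<and> (z, b) \<in> A \<longrightarrow> z = a \<or> z = b)"

definition has_left_endpoint :: "'a rel \<Rightarrow> bool" where
  "has_left_endpoint A \<longleftrightarrow> (\<exists>a. is_left_endpoint A a)"

definition has_right_endpoint :: "'a rel \<Rightarrow> bool" where
  "has_right_endpoint A \<longleftrightarrow> (\<exists>a. is_right_endpoint A a)"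

definition all_have_successors :: "'a rel \<Rightarrow> bool" where
  "all_have_successors A \<longleftrightarrow>
     (\<forall>a\<in>Field A. \<not> is_right_endpoint A a \<longrightarrow> (\<exists>b. is_successor A a b))"

definition all_have_predecessors :: "'a rel \<Rightarrow> bool" where
  "all_have_predecessors A \<longleftrightarrow>
     (\<forall>a\<in>Field A. \<not> is_left_endpoint A a \<longrightarrow> (\<exists>b. is_successor A b a))"

end

theory Submission
  imports Defs "HOL-Library.Product_Lexorder"
begin

text \<open>
  If \<open>A \<^bold>* X \<cong> X\<close> for some \<open>A\<close> with at least two points, then any cut of \<open>X\<close> leaves a convex copy
  of \<open>X\<close> on one side.  Hence ``no convex copy of \<open>X\<close> lies between \<open>x\<close> and \<open>y\<close>'' is an equivalence
  relation with convex classes; the classes are densely ordered, and every type of class that is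
  neither first nor last occurs between any two of them.  By back and forth, \<open>X\<close> is a shuffle of
  these classes between its first class \<open>L\<close> and its last class \<open>R\<close> (either may be missing).
  Conversely, in \<open>L \<^bold>+ shuffle N I \<^bold>+ R\<close> with \<open>I\<close> minimal, the classes defined in the same way by
  convex copies of the shuffle are exactly \<open>L\<close>, \<open>R\<close> and the blocks \<open>I k\<close>.

  In \<open>A \<^bold>* X\<close> the last class of the copy of \<open>X\<close> at \<open>a\<close> merges with the first class of the copy
  at \<open>b\<close> if \<open>b\<close> is the successor of \<open>a\<close>, and no other classes merge.  So \<open>A \<^bold>* X \<cong> X\<close> holds if and
  only if \<open>A\<close> has the endpoints that \<open>L\<close> and \<open>R\<close> require and the new inner classes, \<open>R \<^bold>+ L\<close> at
  successor pairs, \<open>L\<close> at non-first points without predecessor and \<open>R\<close> at non-last points without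
  successor, are empty or occur among the \<open>I k\<close>.
\<close>

section \<open>Isomorphism of orders\<close>

lemma order_isomorphicI:
  assumes "bij_betw f (Field r) (Field s)"
    and "\<And>a b. a \<in> Field r \<Longrightarrow> b \<in> Field r \<Longrightarrow> (a, b) \<in> r \<longleftrightarrow> (f a, f b) \<in> s"
  shows "r \<cong> s"
  using assms by (auto simp: order_isomorphic_def iso_iff2)

lemma order_isomorphicE:
  assumes "r \<cong> s"
  obtains f where "bij_betw f (Field r) (Field s)"
    and "\<And>a b. a \<in> Field r \<Longrightarrow> b \<in> Field r \<Longrightarrow> (a, b) \<in> r \<longleftrightarrow> (f a, f b) \<in> s"
  using assms by (auto simp: order_isomorphic_def iso_iff2)

lemma order_isomorphic_refl [simp]: "r \<cong> r"
  using id_iso by (auto simp: order_isomorphic_def)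

lemma order_isomorphic_sym:
  assumes "r \<cong> s"
  shows "s \<cong> r"
proof -
  obtain f where iso: "iso r s f" using assms by (auto simp: order_isomorphic_def)
  then have bij: "bij_betw f (Field r) (Field s)" by (simp add: iso_iff2)
  show ?thesis
  proof (rule order_isomorphicI)
    show "bij_betw (inv_into (Field r) f) (Field s) (Field r)" using bij by (rule bij_betw_inv_into)
  next
    fix a b assume "a \<in> Field s" "b \<in> Field s"
    then show "(a, b) \<in> s \<longleftrightarrow> (inv_into (Field r) f a, inv_into (Field r) f b) \<in> r"
      using iso_backward[OF _ iso] iso_forward[OF _ iso] bij by (metis bij_betw_inv_into_right)
  qed
qed

lemma order_isomorphic_commute: "r \<cong> s \<longleftrightarrow> s \<cong> r"
  by (rule iffI; erule order_isomorphic_sym)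

lemma order_isomorphic_trans [trans]: "r \<cong> s \<Longrightarrow> s \<cong> t \<Longrightarrow> r \<cong> t"
  unfolding order_isomorphic_def using comp_iso by blast

lemma order_isomorphic_cong: "r \<cong> r' \<Longrightarrow> s \<cong> s' \<Longrightarrow> r \<cong> s \<longleftrightarrow> r' \<cong> s'"
  by (meson order_isomorphic_sym order_isomorphic_trans)

lemma Field_empty_iff: "Field r = {} \<longleftrightarrow> r = {}"
  by (auto simp: Field_def)

lemma order_isomorphic_empty_iff: "r \<cong> s \<Longrightarrow> r = {} \<longleftrightarrow> s = {}"
  by (erule order_isomorphicE) (metis Field_empty_iff bij_betw_empty1 bij_betw_empty2)

lemma Linear_orderD:
  assumes "Linear_order r"
  shows "\<And>a. a \<in> Field r \<Longrightarrow> (a, a) \<in> r"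
    and "\<And>a b c. (a, b) \<in> r \<Longrightarrow> (b, c) \<in> r \<Longrightarrow> (a, c) \<in> r"
    and "\<And>a b. (a, b) \<in> r \<Longrightarrow> (b, a) \<in> r \<Longrightarrow> a = b"
    and "\<And>a b. a \<in> Field r \<Longrightarrow> b \<in> Field r \<Longrightarrow> (a, b) \<in> r \<or> (b, a) \<in> r"
  using assms unfolding order_on_defs refl_on_def trans_def antisym_def total_on_def by metis+

text \<open>
  Countable orders can be treated as subsets of linearly ordered types: each is isomorphic to a
  suborder of the reals, and the lexicographic product of two suborders is the suborder on the
  product set.
\<close>

definition suborder :: "'a::linorder set \<Rightarrow> 'a rel" where
  "suborder S = {(x, y). x \<in> S \<and> y \<in> S \<and> x \<le> y}"

lemma Field_suborder [simp]: "Field (suborder S) = S"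
  by (auto simp: suborder_def Field_def)

lemma suborder_iff [simp]: "(x, y) \<in> suborder S \<longleftrightarrow> x \<in> S \<and> y \<in> S \<and> x \<le> y"
  by (simp add: suborder_def)

lemma suborder_empty_iff [simp]: "suborder S = {} \<longleftrightarrow> S = {}"
  by (metis Field_empty_iff Field_suborder)

lemma suborder_empty_iso [simp]: "suborder {} \<cong> suborder {}"
  by (rule order_isomorphicI) (auto simp: bij_betw_def)

lemma linear_order_on_suborder [simp]: "linear_order_on S (suborder S)"
  by (auto simp: order_on_defs refl_on_def trans_def antisym_def total_on_def)

lemma countable_order_suborder_iff [simp]: "countable_order (suborder S) \<longleftrightarrow> countable S"
  by (simp add: countable_order_def)

lemma order_rat_eq: "\<^bold>Q = suborder UNIV"
  by (auto simp: order_rat_def suborder_def)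

lemma embedding_iso_suborder:
  assumes "inj_on f (Field r)"
    and "\<And>a b. a \<in> Field r \<Longrightarrow> b \<in> Field r \<Longrightarrow> (a, b) \<in> r \<longleftrightarrow> f a \<le> f b"
  shows "r \<cong> suborder (f ` Field r)"
  by (rule order_isomorphicI[of f]) (use assms in \<open>auto simp: bij_betw_def\<close>)

lemma iso_suborderE:
  assumes "r \<cong> suborder S"
  obtains f where "bij_betw f (Field r) S"
    and "\<And>a b. a \<in> Field r \<Longrightarrow> b \<in> Field r \<Longrightarrow> (a, b) \<in> r \<longleftrightarrow> f a \<le> f b"
  using assms by (rule order_isomorphicE) (auto simp: bij_betw_def)

lemma strict_mono_on_image_iso: "strict_mono_on S f \<Longrightarrow> suborder S \<cong> suborder (f ` S)"
  using embedding_iso_suborder[of f "suborder S"]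
  by (simp add: strict_mono_on_imp_inj_on strict_mono_on_less_eq)

lemma suborder_isoE:
  assumes "suborder S \<cong> suborder T"
  obtains f where "strict_mono_on S f" "f ` S = T"
proof -
  obtain f where bij: "bij_betw f S T"
    and order: "\<And>a b. a \<in> S \<Longrightarrow> b \<in> S \<Longrightarrow> a \<le> b \<longleftrightarrow> f a \<le> f b"
    using assms by (rule iso_suborderE) simp
  have "strict_mono_on S f"
    using order by (intro strict_mono_onI) (metis linorder_not_le)
  then show thesis using bij by (intro that[of f]) (simp_all add: bij_betw_def)
qed

lemma Refl_of_iso_suborder: "r \<cong> suborder S \<Longrightarrow> Refl r"
  by (erule iso_suborderE) (auto simp: refl_on_def)

section \<open>Countable orders inside the reals\<close>

lemma suminf_halves_strict_mono:
  fixes A B :: "nat set"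
  assumes "A \<subset> B"
  shows "(\<Sum>n. if n \<in> A then (1/2 :: real) ^ n else 0) < (\<Sum>n. if n \<in> B then (1/2) ^ n else 0)"
proof -
  have summable: "summable (\<lambda>n. if n \<in> C then (1/2 :: real) ^ n else 0)" for C
    by (rule summable_comparison_test'[of "\<lambda>n. (1/2) ^ n" 0]) (auto simp: summable_geometric)
  obtain m where "m \<in> B" "m \<notin> A" using assms by blast
  then have "0 < (\<Sum>n. (if n \<in> B then (1/2 :: real) ^ n else 0) - (if n \<in> A then (1/2) ^ n else 0))"
    using assms by (intro suminf_pos2[of _ m] summable_diff summable) auto
  then show ?thesis using suminf_diff[OF summable summable, of B A] by simp
qed

lemma countable_order_iso_real_suborderE:
  assumes "countable_order r"
  obtains S :: "real set" where "countable S" "r \<cong> suborder S"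
proof -
  have lin: "Linear_order r" and countable: "countable (Field r)"
    using assms by (auto simp: countable_order_def)
  define before where "before x = to_nat_on (Field r) ` {y. (y, x) \<in> r \<and> y \<noteq> x}" for x
  define f where "f x = (\<Sum>n. if n \<in> before x then (1/2 :: real) ^ n else 0)" for x
  have f_less: "f x < f y" if "(x, y) \<in> r" "x \<noteq> y" for x y
    unfolding f_def
  proof (rule suminf_halves_strict_mono, rule psubsetI)
    show "before x \<subseteq> before y"
      unfolding before_def using that Linear_orderD(2,3)[OF lin] by (intro image_mono) blast
    have "to_nat_on (Field r) x \<in> before y" unfolding before_def using that by blast
    moreover have "to_nat_on (Field r) x \<notin> before x"
      using that countable by (auto simp: before_def FieldI1)
    ultimately show "before x \<noteq> before y" by blast
  qed
  have f_order: "(x, y) \<in> r \<longleftrightarrow> f x \<le> f y" if "x \<in> Field r" "y \<in> Field r" for x y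
    using that f_less[of x y] f_less[of y x] Linear_orderD(1,4)[OF lin]
    by (metis leD less_imp_le order_refl)
  then have "inj_on f (Field r)"
    using Linear_orderD(3)[OF lin] by (intro inj_onI) simp
  then have "r \<cong> suborder (f ` Field r)" using f_order by (rule embedding_iso_suborder)
  then show thesis using countable by (intro that) auto
qed

lemma countable_order_iso_nat_relE:
  assumes "countable_order r"
  obtains s :: "nat rel" where "countable_order s" "s \<cong> r"
proof -
  let ?s = "dir_image r (to_nat_on (Field r))"
  have lin: "Linear_order r" and inj: "inj_on (to_nat_on (Field r)) (Field r)"
    using assms by (auto simp: countable_order_def)
  have "r \<cong> ?s"
  proof (rule order_isomorphicI)
    show "bij_betw (to_nat_on (Field r)) (Field r) (Field ?s)"
      using inj by (rule dir_image_bij_betw)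
    fix a b assume "a \<in> Field r" "b \<in> Field r"
    then show "(a, b) \<in> r \<longleftrightarrow> (to_nat_on (Field r) a, to_nat_on (Field r) b) \<in> ?s"
      using inj by (auto simp: dir_image_def) (metis FieldI1 FieldI2 inj_onD)
  qed
  moreover have "countable_order ?s"
    using Linear_order_dir_image[OF lin inj] by (simp add: countable_order_def)
  ultimately show thesis using that order_isomorphic_sym by blast
qed

section \<open>Back and forth\<close>

definition dense_unbounded_in :: "'a::linorder set \<Rightarrow> 'a set \<Rightarrow> bool" where
  "dense_unbounded_in C B \<longleftrightarrow> C \<subseteq> B \<and> C \<noteq> {} \<and> (\<forall>x\<in>B. (\<exists>z\<in>C. z < x) \<and> (\<exists>z\<in>C. x < z)) \<and>
     (\<forall>x\<in>B. \<forall>y\<in>B. x < y \<longrightarrow> (\<exists>z\<in>C. x < z \<and> z < y))"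

lemma dense_unbounded_in_mono:
  "dense_unbounded_in C B \<Longrightarrow> C \<subseteq> C' \<Longrightarrow> C' \<subseteq> B \<Longrightarrow> dense_unbounded_in C' B"
  unfolding dense_unbounded_in_def by (simp, blast)

lemma dense_unbounded_in_interval:
  assumes dense: "dense_unbounded_in C B" and "a \<in> B" "b \<in> B" "a < b"
  shows "dense_unbounded_in (C \<inter> {a<..<b}) (B \<inter> {a<..<b})"
proof -
  have between: "\<exists>z\<in>C \<inter> {a<..<b}. x < z \<and> z < y" if "x \<in> B" "y \<in> B" "x < y" "a \<le> x" "y \<le> b" for x y
  proof -
    obtain z where "z \<in> C" "x < z" "z < y"
      using dense \<open>x \<in> B\<close> \<open>y \<in> B\<close> \<open>x < y\<close> unfolding dense_unbounded_in_def by blast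
    then show ?thesis using that(4,5) by (intro bexI[of _ z]) auto
  qed
  have "C \<inter> {a<..<b} \<noteq> {}" using between[of a b] assms by blast
  moreover have "(\<exists>z\<in>C \<inter> {a<..<b}. z < x) \<and> (\<exists>z\<in>C \<inter> {a<..<b}. x < z)" if "x \<in> B \<inter> {a<..<b}" for x
    using between[of a x] between[of x b] assms that by auto
  ultimately show ?thesis
    using dense between unfolding dense_unbounded_in_def by (auto simp: less_imp_le)
qed

lemma dense_unbounded_in_between_finite:
  assumes dense: "dense_unbounded_in C B"
    and finite: "finite U" "finite V" and subset: "U \<subseteq> B" "V \<subseteq> B"
    and less: "\<And>u v. u \<in> U \<Longrightarrow> v \<in> V \<Longrightarrow> u < v"
  shows "\<exists>z\<in>C. (\<forall>u\<in>U. u < z) \<and> (\<forall>v\<in>V. z < v)"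
proof -
  have Max: "U \<noteq> {} \<Longrightarrow> Max U \<in> U" and Min: "V \<noteq> {} \<Longrightarrow> Min V \<in> V" using finite by simp_all
  then have "U \<noteq> {} \<Longrightarrow> Max U \<in> B" "V \<noteq> {} \<Longrightarrow> Min V \<in> B"
    "U \<noteq> {} \<Longrightarrow> V \<noteq> {} \<Longrightarrow> Max U < Min V"
    using subset less by blast+
  then have "\<exists>z\<in>C. (U \<noteq> {} \<longrightarrow> Max U < z) \<and> (V \<noteq> {} \<longrightarrow> z < Min V)"
    using dense unfolding dense_unbounded_in_def by (cases "U = {}"; cases "V = {}") auto
  then show ?thesis using finite by (metis Max_less_iff Min_gr_iff empty_iff)
qed

definition partial_match ::
    "'a::linorder set \<Rightarrow> 'b::linorder set \<Rightarrow> ('a \<Rightarrow> 'b \<Rightarrow> bool) \<Rightarrow> ('a \<times> 'b) set \<Rightarrow> bool" where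
  "partial_match S T Q F \<longleftrightarrow> finite F \<and> (\<forall>x y. (x, y) \<in> F \<longrightarrow> x \<in> S \<and> y \<in> T \<and> Q x y) \<and>
     (\<forall>x y x' y'. (x, y) \<in> F \<longrightarrow> (x', y') \<in> F \<longrightarrow> (x < x' \<longleftrightarrow> y < y'))"

lemma partial_match_converse:
  "partial_match T S (\<lambda>y x. Q x y) (F\<inverse>) \<longleftrightarrow> partial_match S T Q F"
  unfolding partial_match_def by (simp, blast)

lemma partial_match_extend_Domain:
  assumes match: "partial_match S T Q F" and "x \<in> S"
    and dense: "dense_unbounded_in {y \<in> T. Q x y} T"
  obtains y where "partial_match S T Q (insert (x, y) F)"
proof (cases "x \<in> Domain F")
  case True
  then show thesis using match that by (metis Domain.cases insert_absorb)
next
  case False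
  have finite: "finite F" and F_mem: "\<And>u v. (u, v) \<in> F \<Longrightarrow> u \<in> S \<and> v \<in> T \<and> Q u v"
    and F_order: "\<And>u v u' v'. (u, v) \<in> F \<Longrightarrow> (u', v') \<in> F \<Longrightarrow> u < u' \<longleftrightarrow> v < v'"
    using match unfolding partial_match_def by blast+
  define below above where "below = snd ` {p \<in> F. fst p < x}" and "above = snd ` {p \<in> F. x < fst p}"
  have "finite below" "finite above" "below \<subseteq> T" "above \<subseteq> T"
    using finite F_mem by (auto simp: below_def above_def)
  moreover have "v < v'" if "v \<in> below" "v' \<in> above" for v v'
    using that F_order unfolding below_def above_def by force
  ultimately have "\<exists>y\<in>{y \<in> T. Q x y}. (\<forall>v\<in>below. v < y) \<and> (\<forall>v\<in>above. y < v)"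
    by (rule dense_unbounded_in_between_finite[OF dense])
  then obtain y where partner: "y \<in> T" "Q x y"
    and y_above: "\<And>v. v \<in> below \<Longrightarrow> v < y" and y_below: "\<And>v. v \<in> above \<Longrightarrow> y < v"
    by blast
  have "(u < x \<longleftrightarrow> v < y) \<and> (x < u \<longleftrightarrow> y < v)" if "(u, v) \<in> F" for u v
  proof (cases u x rule: linorder_cases)
    case less
    then have "v \<in> below" using that by (force simp: below_def)
    then show ?thesis using less y_above by (auto dest: less_asym)
  next
    case equal
    then show ?thesis using that False by blast
  next
    case greater
    then have "v \<in> above" using that by (force simp: above_def)
    then show ?thesis using greater y_below by (auto dest: less_asym)
  qed
  then have "partial_match S T Q (insert (x, y) F)"
    unfolding partial_match_def using finite F_mem F_order \<open>x \<in> S\<close> partner by auto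
  then show thesis by (rule that)
qed

lemma partial_match_extend_Range:
  assumes "partial_match S T Q F" "y \<in> T" "dense_unbounded_in {x \<in> S. Q x y} S"
  obtains x where "partial_match S T Q (insert (x, y) F)"
proof -
  obtain x where "partial_match T S (\<lambda>y x. Q x y) (insert (y, x) (F\<inverse>))"
    using partial_match_extend_Domain[of T S "\<lambda>y x. Q x y" "F\<inverse>" y] assms
    by (auto simp: partial_match_converse)
  moreover have "insert (y, x) (F\<inverse>) = (insert (x, y) F)\<inverse>" by auto
  ultimately show thesis using that by (simp add: partial_match_converse)
qed

lemma exhausting_partial_matches:
  assumes "countable S" "S \<noteq> {}" "countable T" "T \<noteq> {}"
    and forward: "\<And>x. x \<in> S \<Longrightarrow> dense_unbounded_in {y \<in> T. Q x y} T"
    and backward: "\<And>y. y \<in> T \<Longrightarrow> dense_unbounded_in {x \<in> S. Q x y} S"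
  obtains F :: "nat \<Rightarrow> ('a::linorder \<times> 'b::linorder) set"
  where "incseq F" "\<And>n. partial_match S T Q (F n)"
    "Domain (\<Union>(range F)) = S" "Range (\<Union>(range F)) = T"
proof -
  have extension: "\<exists>F'. partial_match S T Q F' \<and> F \<subseteq> F' \<and> x \<in> Domain F' \<and> y \<in> Range F'"
    if partial: "partial_match S T Q F" and "x \<in> S" "y \<in> T" for F x y
  proof -
    obtain y' where extended: "partial_match S T Q (insert (x, y') F)"
      using partial \<open>x \<in> S\<close> forward[OF \<open>x \<in> S\<close>] by (rule partial_match_extend_Domain)
    obtain x' where "partial_match S T Q (insert (x', y) (insert (x, y') F))"
      using extended \<open>y \<in> T\<close> backward[OF \<open>y \<in> T\<close>] by (rule partial_match_extend_Range)
    then show ?thesis by blast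
  qed
  have "\<exists>F. \<forall>n. partial_match S T Q (F n) \<and> (F n \<subseteq> F (Suc n) \<and>
      from_nat_into S n \<in> Domain (F (Suc n)) \<and> from_nat_into T n \<in> Range (F (Suc n)))"
    using extension from_nat_into[OF \<open>S \<noteq> {}\<close>] from_nat_into[OF \<open>T \<noteq> {}\<close>]
    by (intro dependent_nat_choice) (auto simp: partial_match_def intro!: exI[of _ "{}"])
  then obtain F where match: "\<And>n. partial_match S T Q (F n)" and incr: "\<And>n. F n \<subseteq> F (Suc n)"
    and domain: "\<And>n. from_nat_into S n \<in> Domain (F (Suc n))"
    and range: "\<And>n. from_nat_into T n \<in> Range (F (Suc n))"
    by blast
  show thesis
  proof
    show "incseq F" using incr by (rule incseq_SucI)
    have "Domain (\<Union>(range F)) \<subseteq> S" "Range (\<Union>(range F)) \<subseteq> T"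
      using match unfolding partial_match_def by blast+
    moreover have "from_nat_into S n \<in> Domain (\<Union>(range F))"
      "from_nat_into T n \<in> Range (\<Union>(range F))" for n
      using domain[of n] range[of n] by blast+
    then have "range (from_nat_into S) \<subseteq> Domain (\<Union>(range F))"
      "range (from_nat_into T) \<subseteq> Range (\<Union>(range F))"
      by blast+
    ultimately show "Domain (\<Union>(range F)) = S" "Range (\<Union>(range F)) = T" using assms(1-4) by simp_all
  qed (rule match)
qed

lemma partial_match_Union:
  assumes "incseq F" and match: "\<And>n. partial_match S T Q (F n)"
    and mem: "(x, y) \<in> \<Union>(range F)" "(x', y') \<in> \<Union>(range F)"
  shows "x < x' \<longleftrightarrow> y < y'" and "Q x y"
proof -
  obtain m n where "(x, y) \<in> F m" "(x', y') \<in> F n" using mem by blast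
  then have "(x, y) \<in> F (max m n)" "(x', y') \<in> F (max m n)"
    using \<open>incseq F\<close> by (meson incseqD max.cobounded1 max.cobounded2 subsetD)+
  then show "x < x' \<longleftrightarrow> y < y'" and "Q x y"
    using match[of "max m n"] unfolding partial_match_def by blast+
qed

theorem back_and_forth:
  fixes S :: "'a::linorder set" and T :: "'b::linorder set"
  assumes "countable S" "countable T"
    and forward: "\<And>x. x \<in> S \<Longrightarrow> dense_unbounded_in {y \<in> T. Q x y} T"
    and backward: "\<And>y. y \<in> T \<Longrightarrow> dense_unbounded_in {x \<in> S. Q x y} S"
  obtains f where "strict_mono_on S f" "f ` S = T" "\<And>x. x \<in> S \<Longrightarrow> Q x (f x)"
proof (cases "S = {} \<or> T = {}")
  case True
  then have "S = {}" "T = {}" using forward backward unfolding dense_unbounded_in_def by blast+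
  then show thesis by (intro that) auto
next
  case False
  then obtain F :: "nat \<Rightarrow> ('a \<times> 'b) set" where matches: "incseq F" "\<And>n. partial_match S T Q (F n)"
    "Domain (\<Union>(range F)) = S" "Range (\<Union>(range F)) = T"
    using exhausting_partial_matches[OF assms(1) _ assms(2) _ forward backward] by blast
  define G where "G = \<Union>(range F)"
  have G_order: "x < x' \<longleftrightarrow> y < y'" and G_compatible: "Q x y"
    if "(x, y) \<in> G" "(x', y') \<in> G" for x y x' y'
    using partial_match_Union[OF matches(1,2)] that unfolding G_def by blast+
  have domain: "Domain G = S" and range: "Range G = T" using matches by (simp_all add: G_def)
  then have "\<forall>x\<in>S. \<exists>y. (x, y) \<in> G" by blast
  from bchoice[OF this] obtain f where f_mem: "\<And>x. x \<in> S \<Longrightarrow> (x, f x) \<in> G" by blast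
  show thesis
  proof
    show "strict_mono_on S f" using f_mem G_order by (intro strict_mono_onI) blast
    have "y \<in> f ` S" if "y \<in> T" for y
    proof -
      obtain x where "(x, y) \<in> G" "x \<in> S" using \<open>y \<in> T\<close> domain range by blast
      then have "y = f x" using f_mem G_order by (meson less_irrefl linorder_neqE)
      then show ?thesis using \<open>x \<in> S\<close> by blast
    qed
    then show "f ` S = T" using f_mem range by blast
    show "Q x (f x)" if "x \<in> S" for x using f_mem G_compatible that by blast
  qed
qed

corollary order_rat_iso_suborder:
  assumes "countable S" "dense_unbounded_in S S"
  shows "\<^bold>Q \<cong> suborder S"
proof -
  have "dense_unbounded_in (UNIV :: rat set) UNIV"
    by (auto simp: dense_unbounded_in_def intro: dense lt_ex gt_ex)
  then obtain f :: "rat \<Rightarrow> _" where "strict_mono_on UNIV f" "f ` UNIV = S"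
    using back_and_forth[of "UNIV :: rat set" S "\<lambda>_ _. True"] assms by auto
  then show ?thesis unfolding order_rat_eq using strict_mono_on_image_iso by metis
qed

section \<open>Sums, replacements and shuffles\<close>

definition precedes :: "'a::linorder set \<Rightarrow> 'a set \<Rightarrow> bool" (infix "\<prec>" 50) where
  "S \<prec> T \<longleftrightarrow> (\<forall>x\<in>S. \<forall>y\<in>T. x < y)"

lemma precedesD: "S \<prec> T \<Longrightarrow> x \<in> S \<Longrightarrow> y \<in> T \<Longrightarrow> x < y"
  by (simp add: precedes_def)

lemma precedes_subset: "S \<prec> T \<Longrightarrow> S' \<subseteq> S \<Longrightarrow> T' \<subseteq> T \<Longrightarrow> S' \<prec> T'"
  unfolding precedes_def by blast

lemma precedes_disjoint: "S \<prec> T \<Longrightarrow> S \<inter> T = {}"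
  by (auto simp: precedes_def)

lemma order_sum_iff [simp]:
  "(Inl a, Inl b) \<in> r \<^bold>+ s \<longleftrightarrow> (a, b) \<in> r"
  "(Inr c, Inr d) \<in> r \<^bold>+ s \<longleftrightarrow> (c, d) \<in> s"
  "(Inl a, Inr d) \<in> r \<^bold>+ s \<longleftrightarrow> a \<in> Field r \<and> d \<in> Field s"
  "(Inr c, Inl b) \<notin> r \<^bold>+ s"
  by (auto simp: order_sum_def)

lemma Field_order_sum: "Field (r \<^bold>+ s) = Inl ` Field r \<union> Inr ` Field s"
proof (intro equalityI subsetI)
  fix p assume "p \<in> Inl ` Field r \<union> Inr ` Field s"
  then obtain q where "(p, q) \<in> r \<^bold>+ s \<or> (q, p) \<in> r \<^bold>+ s"
    by (auto simp: Field_def) (meson order_sum_iff)+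
  then show "p \<in> Field (r \<^bold>+ s)" by (auto simp: Field_def)
qed (auto simp: order_sum_def Field_def)

lemma order_sum_cong:
  assumes "r \<cong> r'" "s \<cong> s'"
  shows "r \<^bold>+ s \<cong> r' \<^bold>+ s'"
proof -
  obtain f where f_bij: "bij_betw f (Field r) (Field r')"
    and f_order: "\<And>a b. a \<in> Field r \<Longrightarrow> b \<in> Field r \<Longrightarrow> (a, b) \<in> r \<longleftrightarrow> (f a, f b) \<in> r'"
    using assms(1) by (rule order_isomorphicE) blast
  obtain g where g_bij: "bij_betw g (Field s) (Field s')"
    and g_order: "\<And>a b. a \<in> Field s \<Longrightarrow> b \<in> Field s \<Longrightarrow> (a, b) \<in> s \<longleftrightarrow> (g a, g b) \<in> s'"
    using assms(2) by (rule order_isomorphicE) blast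
  show ?thesis
  proof (rule order_isomorphicI)
    have "inj_on (map_sum f g) (Inl ` Field r \<union> Inr ` Field s)"
      using bij_betw_imp_inj_on[OF f_bij] bij_betw_imp_inj_on[OF g_bij]
      by (intro inj_onI) (elim UnE imageE; simp add: inj_on_eq_iff)
    then show "bij_betw (map_sum f g) (Field (r \<^bold>+ s)) (Field (r' \<^bold>+ s'))"
      using f_bij g_bij by (auto simp: bij_betw_def Field_order_sum image_Un image_image)
  next
    fix p q assume "p \<in> Field (r \<^bold>+ s)" "q \<in> Field (r \<^bold>+ s)"
    then show "(p, q) \<in> r \<^bold>+ s \<longleftrightarrow> (map_sum f g p, map_sum f g q) \<in> r' \<^bold>+ s'"
      using f_order g_order bij_betwE[OF f_bij] bij_betwE[OF g_bij] by (auto simp: Field_order_sum)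
  qed
qed

lemma suborder_Un_iso:
  assumes "S \<prec> T"
  shows "suborder S \<^bold>+ suborder T \<cong> suborder (S \<union> T)"
proof -
  have image: "case_sum id id ` Field (suborder S \<^bold>+ suborder T) = S \<union> T"
    by (simp add: Field_order_sum image_Un image_image)
  show ?thesis
    unfolding image[symmetric]
    by (rule embedding_iso_suborder)
       (use precedesD[OF assms] in \<open>force simp: Field_order_sum inj_on_def\<close>)+
qed

lemma order_sum_iso_suborderE:
  assumes "r \<^bold>+ s \<cong> suborder S"
  obtains S\<^sub>1 S\<^sub>2 where "S = S\<^sub>1 \<union> S\<^sub>2" "S\<^sub>1 \<prec> S\<^sub>2" "r \<cong> suborder S\<^sub>1" "s \<cong> suborder S\<^sub>2"
proof -
  obtain f where bij: "bij_betw f (Field (r \<^bold>+ s)) S"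
    and order: "\<And>p q. p \<in> Field (r \<^bold>+ s) \<Longrightarrow> q \<in> Field (r \<^bold>+ s) \<Longrightarrow> (p, q) \<in> r \<^bold>+ s \<longleftrightarrow> f p \<le> f q"
    using assms by (rule iso_suborderE) blast
  show thesis
  proof
    show "S = (f \<circ> Inl) ` Field r \<union> (f \<circ> Inr) ` Field s"
      using bij by (auto simp: bij_betw_def Field_order_sum image_Un image_comp)
    show "(f \<circ> Inl) ` Field r \<prec> (f \<circ> Inr) ` Field s"
      using order by (force simp: precedes_def Field_order_sum not_le[symmetric])
    have inj: "inj_on f (Inl ` Field r \<union> Inr ` Field s)"
      using bij by (simp add: bij_betw_def Field_order_sum)
    show "r \<cong> suborder ((f \<circ> Inl) ` Field r)"
    proof (rule embedding_iso_suborder)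
      show "inj_on (f \<circ> Inl) (Field r)" using inj by (auto simp: inj_on_def)
      show "(a, b) \<in> r \<longleftrightarrow> (f \<circ> Inl) a \<le> (f \<circ> Inl) b" if "a \<in> Field r" "b \<in> Field r" for a b
        using order[of "Inl a" "Inl b"] that by (simp add: Field_order_sum)
    qed
    show "s \<cong> suborder ((f \<circ> Inr) ` Field s)"
    proof (rule embedding_iso_suborder)
      show "inj_on (f \<circ> Inr) (Field s)" using inj by (auto simp: inj_on_def)
      show "(a, b) \<in> s \<longleftrightarrow> (f \<circ> Inr) a \<le> (f \<circ> Inr) b" if "a \<in> Field s" "b \<in> Field s" for a b
        using order[of "Inr a" "Inr b"] that by (simp add: Field_order_sum)
    qed
  qed
qed

lemma order_sum_empty_left: "{} \<^bold>+ r \<cong> r"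
  by (rule order_isomorphic_sym, rule order_isomorphicI[of Inr])
     (auto simp: Field_order_sum bij_betw_def)

lemma order_sum_empty_right: "r \<^bold>+ {} \<cong> r"
  by (rule order_isomorphic_sym, rule order_isomorphicI[of Inl])
     (auto simp: Field_order_sum bij_betw_def)

lemma Field_replace_points:
  assumes "\<And>i. i \<in> Field r \<Longrightarrow> Refl (J i)"
  shows "Field (replace_points r J) = (SIGMA i:Field r. Field (J i))"
proof (intro equalityI subsetI)
  fix p assume "p \<in> (SIGMA i:Field r. Field (J i))"
  then have "(p, p) \<in> replace_points r J"
    using assms by (fastforce simp: replace_points_def refl_on_def)
  then show "p \<in> Field (replace_points r J)" by (auto simp: Field_def)
qed (auto simp: Field_def replace_points_def)

lemma iso_suborder_choice:
  assumes "\<And>i. i \<in> A \<Longrightarrow> J i \<cong> suborder (D i)"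
  shows "\<exists>g. \<forall>i\<in>A. bij_betw (g i) (Field (J i)) (D i) \<and>
    (\<forall>x\<in>Field (J i). \<forall>y\<in>Field (J i). (x, y) \<in> J i \<longleftrightarrow> g i x \<le> g i y)"
  using assms by (intro bchoice) (meson iso_suborderE)

lemma replace_points_iso_suborder:
  assumes linear: "Linear_order r" and iso: "\<And>i. i \<in> Field r \<Longrightarrow> J i \<cong> suborder (D i)"
    and increasing: "\<And>i j. (i, j) \<in> r \<Longrightarrow> i \<noteq> j \<Longrightarrow> D i \<prec> D j"
  shows "replace_points r J \<cong> suborder (\<Union>i\<in>Field r. D i)"
proof -
  obtain g where bij: "\<And>i. i \<in> Field r \<Longrightarrow> bij_betw (g i) (Field (J i)) (D i)"
    and g_order: "\<And>i x y. i \<in> Field r \<Longrightarrow> x \<in> Field (J i) \<Longrightarrow> y \<in> Field (J i) \<Longrightarrow>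
      (x, y) \<in> J i \<longleftrightarrow> g i x \<le> g i y"
    using iso_suborder_choice[of "Field r" J D, OF iso] by auto
  let ?f = "\<lambda>(i, x). g i x"
  have Field: "Field (replace_points r J) = (SIGMA i:Field r. Field (J i))"
    using iso by (intro Field_replace_points Refl_of_iso_suborder)
  have g_less: "g i x < g j y"
    if "(i, j) \<in> r" "i \<noteq> j" "x \<in> Field (J i)" "y \<in> Field (J j)" for i j x y
    using increasing[OF that(1,2)] bij_betwE[OF bij] that by (meson FieldI1 FieldI2 precedesD)
  have compare: "i = j \<or> (i, j) \<in> r \<and> g i x < g j y \<or> (i, j) \<notin> r \<and> g j y < g i x"
    if "i \<in> Field r" "j \<in> Field r" "x \<in> Field (J i)" "y \<in> Field (J j)" for i j x y
    using that g_less[of i j x y] g_less[of j i y x] Linear_orderD(4)[OF linear] by blast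
  have "replace_points r J \<cong> suborder (?f ` Field (replace_points r J))"
  proof (rule embedding_iso_suborder)
    show "inj_on ?f (Field (replace_points r J))"
      unfolding Field
    proof (rule inj_onI; elim SigmaE; hypsubst; unfold prod.case)
      fix i x j y
      assume mem: "i \<in> Field r" "x \<in> Field (J i)" "j \<in> Field r" "y \<in> Field (J j)"
        and equal: "g i x = g j y"
      then have "i = j" using compare[of i j x y] by auto
      then show "(i, x) = (j, y)"
        using bij_betw_imp_inj_on[OF bij, of i] mem equal by (simp add: inj_on_eq_iff)
    qed
    fix p q assume "p \<in> Field (replace_points r J)" "q \<in> Field (replace_points r J)"
    then obtain i x j y where pairs: "p = (i, x)" "q = (j, y)"
      and mem: "i \<in> Field r" "j \<in> Field r" "x \<in> Field (J i)" "y \<in> Field (J j)"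
      unfolding Field by blast
    show "(p, q) \<in> replace_points r J \<longleftrightarrow> ?f p \<le> ?f q"
      using mem compare[OF mem] g_order[of i x y] unfolding pairs
      by (cases "i = j") (auto simp: replace_points_def)
  qed
  moreover have "?f ` (SIGMA i:Field r. Field (J i)) = (\<Union>i\<in>Field r. g i ` Field (J i))" by force
  then have "?f ` (SIGMA i:Field r. Field (J i)) = (\<Union>i\<in>Field r. D i)"
    using bij_betw_imp_surj_on[OF bij] by simp
  ultimately show ?thesis by (simp add: Field)
qed

lemma replace_points_iso_suborderE:
  assumes iso: "replace_points r J \<cong> suborder S" and linear: "Linear_order r"
    and refl: "\<And>i. i \<in> Field r \<Longrightarrow> Refl (J i)"
  obtains D where "S = (\<Union>i\<in>Field r. D i)" "\<And>i. i \<in> Field r \<Longrightarrow> J i \<cong> suborder (D i)"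
    "\<And>i j. (i, j) \<in> r \<Longrightarrow> i \<noteq> j \<Longrightarrow> D i \<prec> D j"
proof -
  have Field: "Field (replace_points r J) = (SIGMA i:Field r. Field (J i))"
    using refl by (rule Field_replace_points)
  obtain f where bij: "bij_betw f (SIGMA i:Field r. Field (J i)) S"
    and order: "\<And>p q. p \<in> (SIGMA i:Field r. Field (J i)) \<Longrightarrow> q \<in> (SIGMA i:Field r. Field (J i)) \<Longrightarrow>
      (p, q) \<in> replace_points r J \<longleftrightarrow> f p \<le> f q"
    using iso by (rule iso_suborderE) (simp add: Field)
  have inj: "inj_on f (SIGMA i:Field r. Field (J i))" using bij by (rule bij_betw_imp_inj_on)
  show thesis
  proof
    show "S = (\<Union>i\<in>Field r. (\<lambda>x. f (i, x)) ` Field (J i))"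
      using bij by (auto simp: bij_betw_def)
  next
    fix i assume i_mem: "i \<in> Field r"
    show "J i \<cong> suborder ((\<lambda>x. f (i, x)) ` Field (J i))"
    proof (rule embedding_iso_suborder)
      show "inj_on (\<lambda>x. f (i, x)) (Field (J i))"
        using i_mem by (intro inj_onI) (auto dest: inj_onD[OF inj])
      show "(x, y) \<in> J i \<longleftrightarrow> f (i, x) \<le> f (i, y)" if "x \<in> Field (J i)" "y \<in> Field (J i)" for x y
        using order[of "(i, x)" "(i, y)"] i_mem that by (simp add: replace_points_def)
    qed
  next
    fix i j assume less: "(i, j) \<in> r" "i \<noteq> j"
    then have "i \<in> Field r" "j \<in> Field r" "(j, i) \<notin> r"
      using Linear_orderD(3)[OF linear] by (auto intro: FieldI1 FieldI2)
    then have "\<not> f (j, y) \<le> f (i, x)" if "x \<in> Field (J i)" "y \<in> Field (J j)" for x y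
      using order[of "(j, y)" "(i, x)"] less(2) that by (simp add: replace_points_def)
    then show "(\<lambda>x. f (i, x)) ` Field (J i) \<prec> (\<lambda>x. f (j, x)) ` Field (J j)"
      by (auto simp: precedes_def not_le)
  qed
qed

lemma shuffle_eq_replace_pointsE:
  assumes "index_set N"
  obtains c where "dense_partition N c" "shuffle N I = replace_points (suborder UNIV) (\<lambda>q. I (c q))"
proof
  show "dense_partition N (SOME c. dense_partition N c)"
    using dense_partition_exists[OF assms] by (rule someI_ex)
  show "shuffle N I = replace_points (suborder UNIV) (\<lambda>q. I ((SOME c. dense_partition N c) q))"
    by (simp add: shuffle_def Let_def order_rat_eq)
qed

lemma dense_partition_dense_unbounded_in:
  assumes "dense_partition N c" "k \<in> N"
  shows "dense_unbounded_in {q. c q = k} UNIV"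
proof -
  have "\<exists>q. a < q \<and> q < b \<and> c q = k" if "a < b" for a b
    using assms that by (simp add: dense_partition_def)
  moreover have "a - 1 < a" "a < a + 1" for a :: rat by simp_all
  ultimately show ?thesis unfolding dense_unbounded_in_def by blast
qed

lemma strict_mono_on_Pair: "strict_mono_on S (Pair (a :: 'b::linorder))"
  by (auto simp: monotone_on_def)

lemma Pair_image: "Pair a ` S = {a} \<times> S"
  by auto

lemma suborder_fibre_iso: "suborder S \<cong> suborder ({a} \<times> S)"
  using strict_mono_on_image_iso[OF strict_mono_on_Pair] by (metis Pair_image)

lemma suborder_unique_fibre_iso_iff:
  assumes unique: "\<And>a b. Q a \<Longrightarrow> Q b \<Longrightarrow> a = b"
  shows "suborder ({a. Q a} \<times> S) \<cong> suborder S \<longleftrightarrow> S = {} \<or> (\<exists>a. Q a)"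
proof (cases "\<exists>a. Q a")
  case True
  then obtain a where "{a. Q a} = {a}" using unique by blast
  then show ?thesis using True by (simp add: order_isomorphic_sym[OF suborder_fibre_iso])
next
  case False
  then have "{a. Q a} \<times> S = {}" by simp
  then show ?thesis
    using False order_isomorphic_empty_iff[of "suborder ({a. Q a} \<times> S)" "suborder S"] by auto
qed

lemma suborder_two_fibres_iso:
  assumes "a < b"
  shows "suborder R \<^bold>+ suborder L \<cong> suborder ({a} \<times> R \<union> {b} \<times> L)"
proof -
  have "suborder R \<^bold>+ suborder L \<cong> suborder ({a} \<times> R) \<^bold>+ suborder ({b} \<times> L)"
    by (intro order_sum_cong suborder_fibre_iso)
  also have "\<dots> \<cong> suborder ({a} \<times> R \<union> {b} \<times> L)"
    by (rule suborder_Un_iso) (use assms in \<open>auto simp: precedes_def\<close>)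
  finally show ?thesis .
qed

lemma lex_product_iso_suborder:
  assumes index: "Linear_order A" "A \<cong> suborder B" and fibre: "X \<cong> suborder S"
  shows "A \<^bold>* X \<cong> suborder (B \<times> S)"
proof -
  obtain f where bij: "bij_betw f (Field A) B"
    and order: "\<And>a b. a \<in> Field A \<Longrightarrow> b \<in> Field A \<Longrightarrow> (a, b) \<in> A \<longleftrightarrow> f a \<le> f b"
    using index(2) by (rule iso_suborderE) blast
  have "A \<^bold>* X \<cong> suborder (\<Union>a\<in>Field A. {f a} \<times> S)"
    unfolding lex_product_def
  proof (rule replace_points_iso_suborder[OF index(1)])
    show "X \<cong> suborder ({f a} \<times> S)" for a
      using fibre suborder_fibre_iso by (rule order_isomorphic_trans)
    fix a b assume "(a, b) \<in> A" "a \<noteq> b"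
    then have "f a < f b"
      using order bij
      by (metis FieldI1 FieldI2 bij_betw_inv_into_left order.not_eq_order_implies_strict)
    then show "{f a} \<times> S \<prec> {f b} \<times> S" by (auto simp: precedes_def)
  qed
  moreover have "(\<Union>a\<in>Field A. {f a} \<times> S) = B \<times> S" using bij by (auto simp: bij_betw_def)
  ultimately show ?thesis by simp
qed

section \<open>Convex copies\<close>

definition convex_in :: "'a::linorder set \<Rightarrow> 'a set \<Rightarrow> bool" where
  "convex_in C S \<longleftrightarrow> C \<subseteq> S \<and> (\<forall>x\<in>C. \<forall>y\<in>C. \<forall>z\<in>S. x \<le> z \<longrightarrow> z \<le> y \<longrightarrow> z \<in> C)"

definition contains_copy :: "'p::linorder set \<Rightarrow> 'a::linorder set \<Rightarrow> bool" where
  "contains_copy P S \<longleftrightarrow> (\<exists>C. convex_in C S \<and> suborder P \<cong> suborder C)"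

lemma convex_inI:
  "C \<subseteq> S \<Longrightarrow> (\<And>x y z. x \<in> C \<Longrightarrow> y \<in> C \<Longrightarrow> z \<in> S \<Longrightarrow> x \<le> z \<Longrightarrow> z \<le> y \<Longrightarrow> z \<in> C) \<Longrightarrow> convex_in C S"
  unfolding convex_in_def by blast

lemma convex_in_imp_subset: "convex_in C S \<Longrightarrow> C \<subseteq> S"
  by (simp add: convex_in_def)

lemma convex_in_between:
  "convex_in C S \<Longrightarrow> x \<in> C \<Longrightarrow> y \<in> C \<Longrightarrow> z \<in> S \<Longrightarrow> x \<le> z \<Longrightarrow> z \<le> y \<Longrightarrow> z \<in> C"
  unfolding convex_in_def by blast

lemma convex_in_self [simp]: "convex_in S S"
  by (simp add: convex_in_def)

lemma convex_in_trans: "convex_in C D \<Longrightarrow> convex_in D S \<Longrightarrow> convex_in C S"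
  unfolding convex_in_def by (meson subset_iff)

lemma convex_in_subset: "convex_in C S \<Longrightarrow> C \<subseteq> D \<Longrightarrow> D \<subseteq> S \<Longrightarrow> convex_in C D"
  unfolding convex_in_def by blast

lemma convex_in_interval:
  "convex_in (S \<inter> {x..y}) S" "convex_in (S \<inter> {x..}) S" "convex_in (S \<inter> {..y}) S"
  by (auto simp: convex_in_def)

lemma convex_in_Un_left: "S \<prec> T \<Longrightarrow> convex_in S (S \<union> T)"
  by (rule convex_inI) (auto dest: precedesD)

lemma convex_in_Un_right: "S \<prec> T \<Longrightarrow> convex_in T (S \<union> T)"
  by (rule convex_inI) (auto dest: precedesD)

lemma convex_in_fibre: "a \<in> A \<Longrightarrow> convex_in ({a} \<times> S) (A \<times> S)"
  by (rule convex_inI) auto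

lemma convex_in_image:
  assumes mono: "strict_mono_on S f" and convex: "convex_in C S"
  shows "convex_in (f ` C) (f ` S)"
proof (rule convex_inI)
  note subset = convex_in_imp_subset[OF convex]
  show "f ` C \<subseteq> f ` S" using subset by blast
  fix x y z assume "x \<in> f ` C" "y \<in> f ` C" "z \<in> f ` S" "x \<le> z" "z \<le> y"
  then obtain a b c where "a \<in> C" "b \<in> C" "c \<in> S" "x = f a" "y = f b" "z = f c"
    "f a \<le> f c" "f c \<le> f b"
    by blast
  moreover from this have "a \<le> c" "c \<le> b" using subset strict_mono_on_less_eq[OF mono] by blast+
  ultimately show "z \<in> f ` C" using convex_in_between[OF convex] by blast
qed

lemma contains_copyI: "convex_in C S \<Longrightarrow> suborder P \<cong> suborder C \<Longrightarrow> contains_copy P S"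
  by (auto simp: contains_copy_def)

lemma contains_copy_refl [simp]: "contains_copy P P"
  by (rule contains_copyI[of P]) simp_all

lemma contains_copy_empty_iff: "contains_copy P {} \<longleftrightarrow> P = {}"
  by (auto simp: contains_copy_def convex_in_def dest: order_isomorphic_empty_iff)

lemma contains_copy_mono: "convex_in T S \<Longrightarrow> contains_copy P T \<Longrightarrow> contains_copy P S"
  unfolding contains_copy_def by (meson convex_in_trans)

lemma contains_copy_trans:
  assumes "contains_copy P T" "contains_copy T S"
  shows "contains_copy P S"
proof -
  obtain C where inner: "convex_in C T" "suborder P \<cong> suborder C"
    using assms(1) by (auto simp: contains_copy_def)
  obtain D where outer: "convex_in D S" "suborder T \<cong> suborder D"
    using assms(2) by (auto simp: contains_copy_def)
  obtain f where mono: "strict_mono_on T f" and image: "f ` T = D"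
    using outer(2) by (rule suborder_isoE)
  have "strict_mono_on C f"
    using mono convex_in_imp_subset[OF inner(1)] by (rule monotone_on_subset)
  then have "suborder P \<cong> suborder (f ` C)"
    using inner(2) strict_mono_on_image_iso order_isomorphic_trans by blast
  moreover have "convex_in (f ` C) S"
    using convex_in_image[OF mono inner(1)] image outer(1) convex_in_trans by blast
  ultimately show ?thesis by (intro contains_copyI)
qed

lemma contains_copy_iso:
  assumes "suborder S \<cong> suborder T" "contains_copy P S"
  shows "contains_copy P T"
  using assms(2) contains_copyI[OF convex_in_self assms(1)] by (rule contains_copy_trans)

lemma contains_copy_image:
  assumes "strict_mono_on S f"
  shows "contains_copy P (f ` S) \<longleftrightarrow> contains_copy P S"
  using contains_copy_iso strict_mono_on_image_iso[OF assms] order_isomorphic_sym by metis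

lemma contains_copy_fibre: "contains_copy P ({a} \<times> S) \<longleftrightarrow> contains_copy P S"
  using contains_copy_image[OF strict_mono_on_Pair] by (metis Pair_image)

lemma has_convex_copy_suborder_iff:
  "has_convex_copy (suborder S) (suborder P) \<longleftrightarrow> contains_copy P S"
proof -
  have Restr: "Restr (suborder S) C = suborder C" if "C \<subseteq> S" for C
    using that by (auto simp: suborder_def)
  have convex: "(\<forall>x\<in>C. \<forall>y\<in>C. \<forall>z. (x, z) \<in> suborder S \<and> (z, y) \<in> suborder S \<longrightarrow> z \<in> C) \<longleftrightarrow>
      (\<forall>x\<in>C. \<forall>y\<in>C. \<forall>z\<in>S. x \<le> z \<longrightarrow> z \<le> y \<longrightarrow> z \<in> C)" if "C \<subseteq> S" for C
    unfolding suborder_iff using that by (meson subsetD)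
  have "C \<subseteq> S \<and> (\<forall>x\<in>C. \<forall>y\<in>C. \<forall>z. (x, z) \<in> suborder S \<and> (z, y) \<in> suborder S \<longrightarrow> z \<in> C) \<and>
      suborder P \<cong> Restr (suborder S) C \<longleftrightarrow> convex_in C S \<and> suborder P \<cong> suborder C" for C
    by (cases "C \<subseteq> S") (simp_all only: Restr convex convex_in_def simp_thms)
  then show ?thesis
    unfolding has_convex_copy_def contains_copy_def Field_suborder by (rule ex_cong1)
qed

lemma iso_Restr_image:
  assumes "iso r s f" "C \<subseteq> Field r"
  shows "iso (Restr r C) (Restr s (f ` C)) f"
proof -
  have inj: "inj_on f (Field r)" using assms(1) by (rule iso_imp_inj_on)
  have order: "\<And>a b. a \<in> Field r \<Longrightarrow> b \<in> Field r \<Longrightarrow> (a, b) \<in> r \<longleftrightarrow> (f a, f b) \<in> s"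
    using assms(1) by (simp add: iso_iff2)
  have "Restr s (f ` C) = dir_image (Restr r C) f"
    unfolding dir_image_def using order assms(2) by blast
  then have "Field (Restr s (f ` C)) = f ` Field (Restr r C)" by (simp only: dir_image_Field)
  moreover have "Field (Restr r C) \<subseteq> C" by (rule Field_Restr_subset)
  ultimately show ?thesis
    using order assms(2) inj_on_subset[OF inj] unfolding iso_iff2 bij_betw_def
    by (auto simp: subset_iff)
qed

lemma has_convex_copy_iso:
  assumes "has_convex_copy Z Y" "Z \<cong> Z'" "Y \<cong> Y'"
  shows "has_convex_copy Z' Y'"
proof -
  obtain C where convex: "C \<subseteq> Field Z" "\<forall>x\<in>C. \<forall>y\<in>C. \<forall>z. (x, z) \<in> Z \<and> (z, y) \<in> Z \<longrightarrow> z \<in> C"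
    and copy: "Y \<cong> Restr Z C"
    using assms(1) unfolding has_convex_copy_def by blast
  obtain f where iso: "iso Z Z' f" using assms(2) by (auto simp: order_isomorphic_def)
  then have image: "f ` Field Z = Field Z'"
    and order: "\<And>a b. a \<in> Field Z \<Longrightarrow> b \<in> Field Z \<Longrightarrow> (a, b) \<in> Z \<longleftrightarrow> (f a, f b) \<in> Z'"
    by (simp_all add: iso_iff2 bij_betw_def)
  show ?thesis
    unfolding has_convex_copy_def
  proof (intro exI conjI ballI allI impI)
    show "f ` C \<subseteq> Field Z'" using convex(1) image by blast
    have "Y' \<cong> Y" using assms(3) by (rule order_isomorphic_sym)
    also note copy
    also have "Restr Z C \<cong> Restr Z' (f ` C)"
      using iso_Restr_image[OF iso convex(1)] by (auto simp: order_isomorphic_def)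
    finally show "Y' \<cong> Restr Z' (f ` C)" .
  next
    fix x y z assume mem: "x \<in> f ` C" "y \<in> f ` C" and between: "(x, z) \<in> Z' \<and> (z, y) \<in> Z'"
    then obtain c where "z = f c" "c \<in> Field Z" using image by (metis FieldI2 imageE)
    then show "z \<in> f ` C" using mem between convex order by blast
  qed
qed

lemma has_convex_copy_iff_contains_copy:
  assumes "Z \<cong> suborder S" "Y \<cong> suborder P"
  shows "has_convex_copy Z Y \<longleftrightarrow> contains_copy P S"
  using has_convex_copy_iso[OF _ assms] has_convex_copy_iso[OF _ assms[THEN order_isomorphic_sym]]
  unfolding has_convex_copy_suborder_iff by blast

section \<open>Components\<close>

definition separated :: "'p::linorder set \<Rightarrow> 'a::linorder set \<Rightarrow> 'a \<Rightarrow> 'a \<Rightarrow> bool" where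
  "separated P S x y \<longleftrightarrow> contains_copy P (S \<inter> {x..y})"

definition component :: "'p::linorder set \<Rightarrow> 'a::linorder set \<Rightarrow> 'a \<Rightarrow> 'a set" where
  "component P S x = {y \<in> S. \<not> separated P S x y \<and> \<not> separated P S y x}"

definition lower_end :: "'p::linorder set \<Rightarrow> 'a::linorder set \<Rightarrow> 'a set" where
  "lower_end P S = {x \<in> S. \<forall>y\<in>S. \<not> separated P S y x}"

definition upper_end :: "'p::linorder set \<Rightarrow> 'a::linorder set \<Rightarrow> 'a set" where
  "upper_end P S = {x \<in> S. \<forall>y\<in>S. \<not> separated P S x y}"

definition middle :: "'p::linorder set \<Rightarrow> 'a::linorder set \<Rightarrow> 'a set" where
  "middle P S = S - lower_end P S - upper_end P S"

lemma component_subset: "component P S x \<subseteq> S"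
  by (auto simp: component_def)

lemma ends_subset: "lower_end P S \<subseteq> S" "upper_end P S \<subseteq> S"
  by (auto simp: lower_end_def upper_end_def)

lemma middle_subset: "middle P S \<subseteq> S"
  by (auto simp: middle_def)

lemma middle_iff:
  "x \<in> middle P S \<longleftrightarrow> x \<in> S \<and> (\<exists>y\<in>S. separated P S y x) \<and> (\<exists>y\<in>S. separated P S x y)"
  by (auto simp: middle_def lower_end_def upper_end_def)

lemma separated_mono:
  assumes "separated P S x y" "x' \<le> x" "y \<le> y'"
  shows "separated P S x' y'"
  unfolding separated_def
proof (rule contains_copy_mono)
  show "convex_in (S \<inter> {x..y}) (S \<inter> {x'..y'})"
    using assms(2,3) by (intro convex_inI) auto
  show "contains_copy P (S \<inter> {x..y})"
    using assms(1) by (simp add: separated_def)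
qed

lemma separated_convex:
  assumes "convex_in C S" "x \<in> C" "y \<in> C"
  shows "separated P C x y \<longleftrightarrow> separated P S x y"
proof -
  have "C \<inter> {x..y} = S \<inter> {x..y}"
    using convex_in_imp_subset[OF assms(1)] convex_in_between[OF assms]
    unfolding set_eq_iff Int_iff atLeastAtMost_iff by blast
  then show ?thesis by (simp add: separated_def)
qed

lemma separated_image:
  assumes mono: "strict_mono_on S f" and "x \<in> S" "y \<in> S"
  shows "separated P (f ` S) (f x) (f y) \<longleftrightarrow> separated P S x y"
proof -
  have "f ` S \<inter> {f x..f y} = f ` (S \<inter> {x..y})"
    using assms(2,3) by (auto simp: strict_mono_on_less_eq[OF mono])
  moreover have "strict_mono_on (S \<inter> {x..y}) f" using mono by (auto simp: monotone_on_def)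
  ultimately show ?thesis by (simp add: separated_def contains_copy_image)
qed

lemma lower_end_image: "strict_mono_on S f \<Longrightarrow> lower_end P (f ` S) = f ` lower_end P S"
  by (auto simp: lower_end_def separated_image)

lemma upper_end_image: "strict_mono_on S f \<Longrightarrow> upper_end P (f ` S) = f ` upper_end P S"
  by (auto simp: upper_end_def separated_image)

lemma middle_image: "strict_mono_on S f \<Longrightarrow> middle P (f ` S) = f ` middle P S"
  unfolding set_eq_iff by (auto simp: middle_iff separated_image intro!: imageI)

lemma component_image:
  "strict_mono_on S f \<Longrightarrow> x \<in> S \<Longrightarrow> component P (f ` S) (f x) = f ` component P S x"
  by (auto simp: component_def separated_image)

lemma strict_mono_on_subset_image_iso:
  "strict_mono_on S f \<Longrightarrow> T \<subseteq> S \<Longrightarrow> suborder T \<cong> suborder (f ` T)"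
  by (meson monotone_on_subset strict_mono_on_image_iso)

lemma ends_iso:
  assumes "suborder S \<cong> suborder T"
  shows "suborder (lower_end P S) \<cong> suborder (lower_end P T)"
    and "suborder (upper_end P S) \<cong> suborder (upper_end P T)"
proof -
  obtain f where mono: "strict_mono_on S f" and image: "f ` S = T"
    using assms by (rule suborder_isoE)
  show "suborder (lower_end P S) \<cong> suborder (lower_end P T)"
    using strict_mono_on_subset_image_iso[OF mono ends_subset(1)] lower_end_image[OF mono] image
    by metis
  show "suborder (upper_end P S) \<cong> suborder (upper_end P T)"
    using strict_mono_on_subset_image_iso[OF mono ends_subset(2)] upper_end_image[OF mono] image
    by metis
qed

lemma component_iso_image:
  assumes "strict_mono_on S f" "x \<in> S"
  shows "suborder (component P S x) \<cong> suborder (component P (f ` S) (f x))"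
  using strict_mono_on_subset_image_iso[OF assms(1) component_subset] component_image[OF assms]
  by metis

text \<open>
  Of two disjoint convex copies of \<open>P\<close> inside a copy of \<open>P\<close>, any cut leaves one on one side;
  this makes separation a strict weak order, so that components are convex classes.
\<close>

locale doubling =
  fixes P :: "'p::linorder set"
  assumes nonempty: "P \<noteq> {}"
    and doubling: "\<exists>C D. convex_in C P \<and> convex_in D P \<and> C \<prec> D \<and>
      suborder P \<cong> suborder C \<and> suborder P \<cong> suborder D"
begin

lemma copy_nonempty: "suborder P \<cong> suborder C \<Longrightarrow> C \<noteq> {}"
  using order_isomorphic_empty_iff[of "suborder P" "suborder C"] nonempty by simp

lemma two_copies:
  assumes "contains_copy P S"
  obtains C D where "convex_in C S" "convex_in D S" "C \<prec> D"
    "suborder P \<cong> suborder C" "suborder P \<cong> suborder D"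
proof -
  obtain E where outer: "convex_in E S" "suborder P \<cong> suborder E"
    using assms by (auto simp: contains_copy_def)
  obtain f where mono: "strict_mono_on P f" and image: "f ` P = E"
    using outer(2) by (rule suborder_isoE)
  obtain C D where convex: "convex_in C P" "convex_in D P" and "C \<prec> D"
    and copies: "suborder P \<cong> suborder C" "suborder P \<cong> suborder D"
    using doubling by blast
  have subset: "C \<subseteq> P" "D \<subseteq> P" using convex by (simp_all add: convex_in_imp_subset)
  show thesis
  proof
    show "convex_in (f ` C) S" "convex_in (f ` D) S"
      using convex_in_image[OF mono] convex image outer(1) convex_in_trans by blast+
    show "suborder P \<cong> suborder (f ` C)"
      using copies(1) strict_mono_on_subset_image_iso[OF mono subset(1)]
      by (rule order_isomorphic_trans)
    show "suborder P \<cong> suborder (f ` D)"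
      using copies(2) strict_mono_on_subset_image_iso[OF mono subset(2)]
      by (rule order_isomorphic_trans)
    show "f ` C \<prec> f ` D"
      using \<open>C \<prec> D\<close> subset strict_mono_onD[OF mono] unfolding precedes_def by blast
  qed
qed

lemma contains_copy_Un_iff:
  assumes "S \<prec> T"
  shows "contains_copy P (S \<union> T) \<longleftrightarrow> contains_copy P S \<or> contains_copy P T"
proof
  assume "contains_copy P (S \<union> T)"
  then obtain C D where convex: "convex_in C (S \<union> T)" "convex_in D (S \<union> T)" and "C \<prec> D"
    and copies: "suborder P \<cong> suborder C" "suborder P \<cong> suborder D"
    by (rule two_copies)
  have subset: "C \<subseteq> S \<union> T" "D \<subseteq> S \<union> T" using convex by (simp_all add: convex_in_imp_subset)
  have "C \<subseteq> S \<or> D \<subseteq> T"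
  proof (rule ccontr)
    assume "\<not> ?thesis"
    then obtain x y where "x \<in> C" "x \<in> T" "y \<in> D" "y \<in> S" using subset by blast
    then show False using precedesD[OF \<open>C \<prec> D\<close>, of x y] precedesD[OF \<open>S \<prec> T\<close>, of y x] by simp
  qed
  then show "contains_copy P S \<or> contains_copy P T"
    using convex copies contains_copyI convex_in_subset by blast
next
  assume "contains_copy P S \<or> contains_copy P T"
  then show "contains_copy P (S \<union> T)"
    using contains_copy_mono convex_in_Un_left[OF assms] convex_in_Un_right[OF assms] by blast
qed

lemma separated_exists:
  assumes "contains_copy P S"
  obtains x y where "x \<in> S" "y \<in> S" "separated P S x y"
proof -
  obtain C E where convex: "convex_in C S" "convex_in E S" and "C \<prec> E"
    and copies: "suborder P \<cong> suborder C" "suborder P \<cong> suborder E"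
    using assms by (rule two_copies)
  have "contains_copy P C" using copies(1) by (rule contains_copyI[OF convex_in_self])
  then obtain B D where inner: "convex_in B C" "convex_in D C" and "B \<prec> D"
    and inner_copies: "suborder P \<cong> suborder B" "suborder P \<cong> suborder D"
    by (rule two_copies)
  obtain x y where x_mem: "x \<in> B" and y_mem: "y \<in> E"
    using copy_nonempty[OF inner_copies(1)] copy_nonempty[OF copies(2)] by auto
  have subset: "B \<subseteq> C" "D \<subseteq> C" "C \<subseteq> S" "E \<subseteq> S"
    using convex inner by (simp_all add: convex_in_imp_subset)
  have "D \<subseteq> S \<inter> {x..y}"
    using subset x_mem y_mem precedesD[OF \<open>B \<prec> D\<close> x_mem] precedesD[OF \<open>C \<prec> E\<close> _ y_mem]
    by (force intro: less_imp_le)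
  then have "convex_in D (S \<inter> {x..y})"
    by (rule convex_in_subset[OF convex_in_trans[OF inner(2) convex(1)]]) simp
  then have "separated P S x y"
    unfolding separated_def using inner_copies(2) by (rule contains_copyI)
  then show thesis using that x_mem y_mem subset by blast
qed

lemma contains_copy_convex_iff:
  assumes "convex_in C S"
  shows "contains_copy P C \<longleftrightarrow> (\<exists>x\<in>C. \<exists>y\<in>C. separated P S x y)"
proof
  assume "contains_copy P C"
  then show "\<exists>x\<in>C. \<exists>y\<in>C. separated P S x y"
    using separated_convex[OF assms] by (metis separated_exists)
next
  assume "\<exists>x\<in>C. \<exists>y\<in>C. separated P S x y"
  then obtain x y where "contains_copy P (C \<inter> {x..y})"
    using separated_convex[OF assms] by (metis separated_def)
  then show "contains_copy P C" by (rule contains_copy_mono[OF convex_in_interval(1)])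
qed

lemma separated_less:
  assumes "separated P S x y"
  shows "x < y"
proof -
  obtain C D where convex: "convex_in C (S \<inter> {x..y})" "convex_in D (S \<inter> {x..y})" and "C \<prec> D"
    and copies: "suborder P \<cong> suborder C" "suborder P \<cong> suborder D"
    using assms unfolding separated_def by (rule two_copies)
  obtain u v where "u \<in> C" "v \<in> D"
    using copy_nonempty[OF copies(1)] copy_nonempty[OF copies(2)] by auto
  then show "x < y"
    using precedesD[OF \<open>C \<prec> D\<close>, of u v] convex[THEN convex_in_imp_subset] by fastforce
qed

lemma separated_irrefl [simp]: "\<not> separated P S x x"
  using separated_less by blast

lemma separated_split:
  assumes "separated P S x z"
  shows "separated P S x y \<or> separated P S y z"
proof -
  consider (below) "y \<le> x" | (above) "z \<le> y" | (between) "x \<le> y" "y \<le> z" by fastforce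
  then show ?thesis
  proof cases
    case between
    then have "S \<inter> {x..z} = S \<inter> {x..y} \<union> S \<inter> {y<..z}" by auto
    moreover have "S \<inter> {x..y} \<prec> S \<inter> {y<..z}" by (auto simp: precedes_def)
    ultimately have "contains_copy P (S \<inter> {x..y}) \<or> contains_copy P (S \<inter> {y<..z})"
      using assms contains_copy_Un_iff[of "S \<inter> {x..y}" "S \<inter> {y<..z}"] by (simp add: separated_def)
    moreover have "convex_in (S \<inter> {y<..z}) (S \<inter> {y..z})" by (rule convex_inI) auto
    ultimately show ?thesis unfolding separated_def using contains_copy_mono by blast
  qed (use assms separated_mono in blast)+
qed

lemma separated_dense:
  assumes "separated P S x y"
  obtains z where "z \<in> S" "separated P S x z" "separated P S z y"
proof -
  obtain C D where convex: "convex_in C (S \<inter> {x..y})" "convex_in D (S \<inter> {x..y})" and "C \<prec> D"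
    and copies: "suborder P \<cong> suborder C" "suborder P \<cong> suborder D"
    using assms unfolding separated_def by (rule two_copies)
  obtain u v where lower_pair: "u \<in> C" "v \<in> C" "separated P C u v"
    using contains_copyI[OF convex_in_self copies(1)] by (rule separated_exists)
  obtain u' v' where upper_pair: "u' \<in> D" "v' \<in> D" "separated P D u' v'"
    using contains_copyI[OF convex_in_self copies(2)] by (rule separated_exists)
  have subset: "C \<subseteq> S \<inter> {x..y}" "D \<subseteq> S \<inter> {x..y}" using convex by (blast dest: convex_in_imp_subset)+
  have "convex_in C S" "convex_in D S" using convex convex_in_interval(1) convex_in_trans by blast+
  then have "separated P S u v" "separated P S u' v'"
    using lower_pair upper_pair separated_convex by blast+
  moreover have "x \<le> u" "v \<le> u'" "v' \<le> y" "v \<in> S"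
    using lower_pair(1,2) upper_pair(1,2) subset precedesD[OF \<open>C \<prec> D\<close> lower_pair(2) upper_pair(1)]
    by auto
  ultimately show thesis using that separated_mono by (meson order_refl)
qed

lemma component_self: "x \<in> S \<Longrightarrow> x \<in> component P S x"
  by (simp add: component_def)

lemma separated_component:
  assumes "x' \<in> component P S x" "y' \<in> component P S y" "separated P S x y"
  shows "separated P S x' y'"
  using assms unfolding component_def by (blast dest: separated_split)

lemma component_eq: "y \<in> component P S x \<Longrightarrow> component P S y = component P S x"
  unfolding component_def by (blast dest: separated_split)

lemma component_convex: "convex_in (component P S x) S"
proof (rule convex_inI)
  fix u v w assume mem: "u \<in> component P S x" "v \<in> component P S x" "w \<in> S"
    and between: "u \<le> w" "w \<le> v"
  have "\<not> separated P S x v" "\<not> separated P S u x" using mem by (simp_all add: component_def)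
  then have "\<not> separated P S x w" "\<not> separated P S w x"
    using separated_mono between by (meson order_refl)+
  then show "w \<in> component P S x" using mem(3) by (simp add: component_def)
qed (rule component_subset)

lemma component_no_copy: "\<not> contains_copy P (component P S x)"
proof -
  have "\<not> separated P S u v" if "u \<in> component P S x" "v \<in> component P S x" for u v
    using that unfolding component_def by (blast dest: separated_split)
  then show ?thesis using contains_copy_convex_iff[OF component_convex] by blast
qed

lemma component_middle_convex:
  assumes convex: "convex_in C S" and middle: "x \<in> middle P C"
  shows "x \<in> middle P S" "component P S x = component P C x"
proof -
  obtain u v where bounds: "u \<in> C" "v \<in> C" "separated P C u x" "separated P C x v"
    and x_mem: "x \<in> C"
    using middle by (auto simp: middle_iff)
  have subset: "C \<subseteq> S" using convex by (rule convex_in_imp_subset)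
  have bounds_separated: "separated P S u x" "separated P S x v"
    using bounds x_mem separated_convex[OF convex] by blast+
  then show "x \<in> middle P S" using bounds x_mem subset by (auto simp: middle_iff)
  have "y \<in> C" if not_separated: "y \<in> S" "\<not> separated P S x y" "\<not> separated P S y x" for y
  proof -
    have "separated P S u y" "separated P S y v"
      using bounds_separated not_separated separated_split by blast+
    then have "u \<le> y" "y \<le> v" using separated_less less_imp_le by blast+
    then show ?thesis using convex_in_between[OF convex bounds(1,2) not_separated(1)] by blast
  qed
  then show "component P S x = component P C x"
    unfolding component_def using subset separated_convex[OF convex] x_mem by blast
qed

lemma component_between:
  assumes "separated P S x y" and w_middle: "w \<in> middle P P"
  obtains z where "z \<in> S" "separated P S x z" "separated P S z y"
    "suborder (component P P w) \<cong> suborder (component P S z)"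
proof -
  obtain C where copy: "convex_in C (S \<inter> {x..y})" "suborder P \<cong> suborder C"
    using assms(1) by (auto simp: separated_def contains_copy_def)
  then have convex: "convex_in C S" using convex_in_interval(1) convex_in_trans by blast
  obtain f where mono: "strict_mono_on P f" and image: "f ` P = C"
    using copy(2) by (rule suborder_isoE)
  have image_middle: "f w \<in> middle P C" using middle_image[OF mono] image w_middle by blast
  then obtain u v where bounds: "u \<in> C" "v \<in> C" "separated P C u (f w)" "separated P C (f w) v"
    and image_mem: "f w \<in> C"
    by (auto simp: middle_iff)
  have "x \<le> u" "v \<le> y" using bounds(1,2) convex_in_imp_subset[OF copy(1)] by auto
  moreover have "separated P S u (f w)" "separated P S (f w) v"
    using bounds image_mem separated_convex[OF convex] by blast+
  ultimately have "separated P S x (f w)" "separated P S (f w) y"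
    using separated_mono by (meson order_refl)+
  moreover have "f w \<in> S" using image_mem convex_in_imp_subset[OF convex] by blast
  moreover have "suborder (component P P w) \<cong> suborder (component P S (f w))"
    using component_iso_image[OF mono, of w P] image w_middle
      component_middle_convex(2)[OF convex image_middle]
    by (simp add: middle_iff)
  ultimately show thesis using that by blast
qed

lemma lower_end_precedes: "lower_end P S \<prec> S - lower_end P S"
  unfolding precedes_def lower_end_def using separated_split separated_less by blast

lemma upper_end_succeeds: "S - upper_end P S \<prec> upper_end P S"
  unfolding precedes_def upper_end_def using separated_split separated_less by blast

lemma component_lower_end: "x \<in> lower_end P S \<Longrightarrow> component P S x = lower_end P S"
  unfolding component_def lower_end_def using separated_split by blast

lemma component_upper_end: "x \<in> upper_end P S \<Longrightarrow> component P S x = upper_end P S"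
  unfolding component_def upper_end_def using separated_split by blast

lemma ends_disjoint:
  assumes "contains_copy P S"
  shows "lower_end P S \<inter> upper_end P S = {}"
proof -
  obtain u v where "u \<in> S" "v \<in> S" "separated P S u v"
    using assms by (rule separated_exists)
  then show ?thesis
    unfolding lower_end_def upper_end_def using separated_split by blast
qed

lemma ends_middle_Un:
  assumes "contains_copy P S"
  shows "lower_end P S \<union> (middle P S \<union> upper_end P S) = S"
    and "lower_end P S \<prec> middle P S \<union> upper_end P S" "middle P S \<prec> upper_end P S"
proof -
  show "lower_end P S \<union> (middle P S \<union> upper_end P S) = S"
    using ends_subset[of P S] by (auto simp: middle_def)
  show "lower_end P S \<prec> middle P S \<union> upper_end P S"
    using ends_disjoint[OF assms] ends_subset(2)[of P S]
    by (intro precedes_subset[OF lower_end_precedes]) (auto simp: middle_def)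
  show "middle P S \<prec> upper_end P S"
    by (rule precedes_subset[OF upper_end_succeeds]) (auto simp: middle_def)
qed

lemma middle_component: "x \<in> middle P S \<Longrightarrow> y \<in> component P S x \<Longrightarrow> y \<in> middle P S"
  unfolding middle_iff component_def using separated_split by blast

definition transversal :: "'a::linorder set \<Rightarrow> 'a set \<Rightarrow> bool" where
  "transversal S B \<longleftrightarrow> B \<subseteq> middle P S \<and> (\<forall>x\<in>middle P S. \<exists>b\<in>B. x \<in> component P S b) \<and>
     (\<forall>a\<in>B. \<forall>b\<in>B. a < b \<longrightarrow> separated P S a b)"

lemma transversal_exists: obtains B where "transversal S B"
proof
  define rep where "rep x = (SOME y. y \<in> component P S x)" for x
  have rep_mem: "rep x \<in> component P S x" if "x \<in> middle P S" for x
    using component_self middle_subset that unfolding rep_def by (metis someI subsetD)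
  show "transversal S (rep ` middle P S)"
    unfolding transversal_def
  proof (intro conjI ballI impI)
    show "rep ` middle P S \<subseteq> middle P S" using rep_mem middle_component by blast
    show "\<exists>b\<in>rep ` middle P S. x \<in> component P S b" if "x \<in> middle P S" for x
      using component_eq[OF rep_mem[OF that]] component_self middle_subset that by blast
    fix a b assume "a \<in> rep ` middle P S" "b \<in> rep ` middle P S" and "a < b"
    then obtain x y where classes: "x \<in> middle P S" "y \<in> middle P S" "a = rep x" "b = rep y"
      by blast
    then have mem: "a \<in> component P S x" "b \<in> component P S y" using rep_mem by simp_all
    have "component P S x \<noteq> component P S y" using classes \<open>a < b\<close> by (auto simp: rep_def)
    then have "b \<notin> component P S a" using component_eq[of b S a] mem[THEN component_eq] by auto
    moreover have "\<not> separated P S b a" using separated_less[of S b a] \<open>a < b\<close> by auto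
    moreover have "b \<in> S" using mem(2) component_subset by blast
    ultimately show "separated P S a b" by (simp add: component_def)
  qed
qed

end

section \<open>Orders as shuffles of their components\<close>

definition is_block :: "nat set \<Rightarrow> (nat \<Rightarrow> 'i rel) \<Rightarrow> 'a rel \<Rightarrow> bool" where
  "is_block N I r \<longleftrightarrow> (\<exists>k\<in>N. r \<cong> I k)"

lemma is_block_cong: "r \<cong> s \<Longrightarrow> is_block N I r \<longleftrightarrow> is_block N I s"
  unfolding is_block_def using order_isomorphic_cong[OF _ order_isomorphic_refl] by blast

locale component_types = doubling P for P :: "'p::linorder set" +
  fixes N :: "nat set" and I :: "nat \<Rightarrow> 'i rel"
  assumes index_set: "index_set N"
    and types_occur: "k \<in> N \<Longrightarrow> \<exists>w\<in>middle P P. I k \<cong> suborder (component P P w)"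
begin

definition composed_of_blocks :: "'a::linorder set \<Rightarrow> bool" where
  "composed_of_blocks S \<longleftrightarrow> (\<forall>x\<in>middle P S. is_block N I (suborder (component P S x)))"

lemma composed_of_blocks_iso:
  assumes "suborder S \<cong> suborder T" "composed_of_blocks S"
  shows "composed_of_blocks T"
  unfolding composed_of_blocks_def
proof
  fix y assume y_middle: "y \<in> middle P T"
  obtain f where mono: "strict_mono_on S f" and image: "f ` S = T"
    using assms(1) by (rule suborder_isoE)
  obtain x where "x \<in> middle P S" "y = f x"
    using y_middle image middle_image[OF mono] by auto
  then show "is_block N I (suborder (component P T y))"
    using assms(2) component_iso_image[OF mono, of x P] image is_block_cong middle_subset
    unfolding composed_of_blocks_def by blast
qed

lemma transversal_dense:
  assumes copy: "contains_copy P S" and transversal: "transversal S B" and index: "k \<in> N"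
  shows "dense_unbounded_in {b \<in> B. I k \<cong> suborder (component P S b)} B"
    (is "dense_unbounded_in ?C B")
proof -
  have B_middle: "B \<subseteq> middle P S" and cover: "\<And>x. x \<in> middle P S \<Longrightarrow> \<exists>b\<in>B. x \<in> component P S b"
    and B_separated: "\<And>a b. a \<in> B \<Longrightarrow> b \<in> B \<Longrightarrow> a < b \<Longrightarrow> separated P S a b"
    using transversal unfolding transversal_def by blast+
  have between: "\<exists>b\<in>?C. x < b \<and> b < y" if ends: "x \<in> S" "y \<in> S" "separated P S x y" for x y
  proof -
    obtain w where pattern: "w \<in> middle P P" "I k \<cong> suborder (component P P w)"
      using types_occur index by blast
    obtain z where occurrence: "z \<in> S" "separated P S x z" "separated P S z y"
      and type: "suborder (component P P w) \<cong> suborder (component P S z)"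
      using ends(3) pattern(1) by (rule component_between)
    obtain b where representative: "b \<in> B" "z \<in> component P S b"
      using cover occurrence ends by (auto simp: middle_iff)
    have "component P S z = component P S b" using representative(2) by (rule component_eq)
    then have "I k \<cong> suborder (component P S b)"
      using order_isomorphic_trans[OF pattern(2) type] by simp
    moreover have "b \<in> S" using representative(1) B_middle middle_subset by blast
    then have "b \<in> component P S z" using representative(2) by (simp add: component_def)
    then have "separated P S x b" "separated P S b y"
      using occurrence separated_component component_self ends(1,2) by blast+
    ultimately show ?thesis using representative(1) separated_less by blast
  qed
  have "(\<exists>b\<in>?C. b < x) \<and> (\<exists>b\<in>?C. x < b)" if "x \<in> B" for x
  proof -
    obtain y y' where "x \<in> S" "y \<in> S" "separated P S y x" "y' \<in> S" "separated P S x y'"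
      using B_middle \<open>x \<in> B\<close> middle_iff by blast
    then show ?thesis using between by meson
  qed
  moreover have "?C \<noteq> {}"
    using copy by (rule separated_exists) (use between in blast)
  moreover have "\<exists>b\<in>?C. x < b \<and> b < y" if "x \<in> B" "y \<in> B" "x < y" for x y
    using between[OF _ _ B_separated[OF that]] B_middle middle_subset that(1,2) by (meson subsetD)
  ultimately show ?thesis unfolding dense_unbounded_in_def by (intro conjI ballI impI) auto
qed

lemma shuffle_iso_middle:
  assumes order: "contains_copy P S" "countable S" and composed: "composed_of_blocks S"
  shows "shuffle N I \<cong> suborder (middle P S)"
proof -
  obtain c where partition: "dense_partition N c"
    and shuffle: "shuffle N I = replace_points (suborder UNIV) (\<lambda>q. I (c q))"
    using index_set by (rule shuffle_eq_replace_pointsE)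
  have index: "c q \<in> N" for q using partition by (auto simp: dense_partition_def)
  obtain B where transversal: "transversal S B" by (rule transversal_exists)
  then have B_middle: "B \<subseteq> middle P S" and cover: "\<And>x. x \<in> middle P S \<Longrightarrow> \<exists>b\<in>B. x \<in> component P S b"
    and B_separated: "\<And>a b. a \<in> B \<Longrightarrow> b \<in> B \<Longrightarrow> a < b \<Longrightarrow> separated P S a b"
    unfolding transversal_def by blast+
  obtain h where mono: "strict_mono_on UNIV h" and image: "h ` (UNIV :: rat set) = B"
    and type: "\<And>q. I (c q) \<cong> suborder (component P S (h q))"
  proof (rule back_and_forth)
    show "countable (UNIV :: rat set)" by simp
    show "countable B" using B_middle middle_subset order(2) by (meson countable_subset)
    show "dense_unbounded_in {b \<in> B. I (c q) \<cong> suborder (component P S b)} B" for q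
      using order(1) transversal index by (rule transversal_dense)
    fix b assume "b \<in> B"
    then obtain k where block: "k \<in> N" "I k \<cong> suborder (component P S b)"
      using composed B_middle order_isomorphic_sym unfolding composed_of_blocks_def is_block_def
      by blast
    show "dense_unbounded_in {q \<in> UNIV. I (c q) \<cong> suborder (component P S b)} UNIV"
      using dense_partition_dense_unbounded_in[OF partition block(1)]
      by (rule dense_unbounded_in_mono) (use block(2) in auto)
  qed blast
  have "shuffle N I \<cong> suborder (\<Union>q\<in>Field (suborder UNIV). component P S (h q))"
    unfolding shuffle
  proof (rule replace_points_iso_suborder)
    fix p q :: rat assume "(p, q) \<in> suborder UNIV" "p \<noteq> q"
    then have "separated P S (h p) (h q)"
      using mono image by (intro B_separated) (auto simp: strict_mono_on_less)
    then show "component P S (h p) \<prec> component P S (h q)"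
      unfolding precedes_def using separated_component separated_less by blast
  qed (simp_all add: type)
  moreover have "(\<Union>q. component P S (h q)) = middle P S"
    using image B_middle middle_component cover by blast
  ultimately show ?thesis by simp
qed

theorem shuffle_decomposition:
  assumes "contains_copy P S" "countable S" "composed_of_blocks S"
  shows "suborder S \<cong> suborder (lower_end P S) \<^bold>+ shuffle N I \<^bold>+ suborder (upper_end P S)"
proof -
  note parts = ends_middle_Un[OF assms(1)]
  have "shuffle N I \<^bold>+ suborder (upper_end P S) \<cong> suborder (middle P S) \<^bold>+ suborder (upper_end P S)"
    using shuffle_iso_middle[OF assms] by (intro order_sum_cong) simp_all
  also have "\<dots> \<cong> suborder (middle P S \<union> upper_end P S)" using parts(3) by (rule suborder_Un_iso)
  finally have "suborder (lower_end P S) \<^bold>+ shuffle N I \<^bold>+ suborder (upper_end P S) \<cong>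
      suborder (lower_end P S) \<^bold>+ suborder (middle P S \<union> upper_end P S)"
    by (rule order_sum_cong[OF order_isomorphic_refl])
  also have "\<dots> \<cong> suborder (lower_end P S \<union> (middle P S \<union> upper_end P S))"
    using parts(2) by (rule suborder_Un_iso)
  finally show ?thesis unfolding parts(1) by (rule order_isomorphic_sym)
qed

corollary suborder_iso_iff_ends_iso:
  assumes source: "contains_copy P S" "countable S" "composed_of_blocks S"
    and target: "contains_copy P T" "countable T"
  shows "suborder T \<cong> suborder S \<longleftrightarrow> composed_of_blocks T \<and>
    suborder (lower_end P T) \<cong> suborder (lower_end P S) \<and>
    suborder (upper_end P T) \<cong> suborder (upper_end P S)"
proof (intro iffI conjI)
  assume iso: "suborder T \<cong> suborder S"
  show "composed_of_blocks T"
    using order_isomorphic_sym[OF iso] source(3) by (rule composed_of_blocks_iso)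
  show "suborder (lower_end P T) \<cong> suborder (lower_end P S)"
    "suborder (upper_end P T) \<cong> suborder (upper_end P S)"
    using iso by (rule ends_iso)+
next
  assume ends: "composed_of_blocks T \<and>
    suborder (lower_end P T) \<cong> suborder (lower_end P S) \<and>
    suborder (upper_end P T) \<cong> suborder (upper_end P S)"
  then have "suborder T \<cong> suborder (lower_end P T) \<^bold>+ shuffle N I \<^bold>+ suborder (upper_end P T)"
    using target by (intro shuffle_decomposition) simp_all
  also have "\<dots> \<cong> suborder (lower_end P S) \<^bold>+ shuffle N I \<^bold>+ suborder (upper_end P S)"
    using ends by (intro order_sum_cong) simp_all
  also have "\<dots> \<cong> suborder S"
    using source by (intro order_isomorphic_sym[OF shuffle_decomposition])
  finally show "suborder T \<cong> suborder S" .
qed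

end

section \<open>Components of a lexicographic product\<close>

lemma is_left_endpoint_suborder: "is_left_endpoint (suborder A) a \<longleftrightarrow> a \<in> A \<and> (\<forall>b\<in>A. a \<le> b)"
  by (auto simp: is_left_endpoint_def)

lemma is_right_endpoint_suborder: "is_right_endpoint (suborder A) a \<longleftrightarrow> a \<in> A \<and> (\<forall>b\<in>A. b \<le> a)"
  by (auto simp: is_right_endpoint_def)

lemma is_successor_suborder:
  "is_successor (suborder A) a b \<longleftrightarrow> a \<in> A \<and> b \<in> A \<and> a < b \<and> \<not> (\<exists>c\<in>A. a < c \<and> c < b)"
  unfolding is_successor_def suborder_iff by (metis order.strict_iff_order)

lemma is_successor_suborder_unique:
  assumes "is_successor (suborder A) a b"
  shows "{c. is_successor (suborder A) a c} = {b}" "{c. is_successor (suborder A) c b} = {a}"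
  using assms by (auto simp: is_successor_suborder) (meson linorder_neqE)+

context doubling
begin

lemma contains_copy_atLeast_iff:
  assumes "x \<in> S"
  shows "contains_copy P (S \<inter> {x..}) \<longleftrightarrow> x \<notin> upper_end P S"
  unfolding contains_copy_convex_iff[OF convex_in_interval(2)] upper_end_def
  using assms by (auto intro: separated_mono dest: separated_less intro!: less_imp_le)

lemma contains_copy_atMost_iff:
  assumes "y \<in> S"
  shows "contains_copy P (S \<inter> {..y}) \<longleftrightarrow> y \<notin> lower_end P S"
  unfolding contains_copy_convex_iff[OF convex_in_interval(3)] lower_end_def
  using assms by (auto intro: separated_mono dest: separated_less intro!: less_imp_le)

lemma contains_copy_lex: "A \<noteq> {} \<Longrightarrow> contains_copy P S \<Longrightarrow> contains_copy P (A \<times> S)"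
  using contains_copy_mono[OF convex_in_fibre] by (metis contains_copy_fibre ex_in_conv)

lemma separated_lex_same:
  assumes "a \<in> A" "x \<in> S" "y \<in> S"
  shows "separated P (A \<times> S) (a, x) (a, y) \<longleftrightarrow> separated P S x y"
proof -
  have "separated P (A \<times> S) (a, x) (a, y) \<longleftrightarrow> separated P ({a} \<times> S) (a, x) (a, y)"
    using separated_convex[OF convex_in_fibre[OF assms(1)]] assms by blast
  also have "\<dots> \<longleftrightarrow> separated P S x y"
    using separated_image[OF strict_mono_on_Pair] assms by (metis Pair_image)
  finally show ?thesis .
qed

lemma separated_lex_successor:
  assumes succ: "is_successor (suborder A) a b" and "x \<in> S" "y \<in> S"
  shows "separated P (A \<times> S) (a, x) (b, y) \<longleftrightarrow> x \<notin> upper_end P S \<or> y \<notin> lower_end P S"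
proof -
  have points: "a \<in> A" "b \<in> A" "a < b" and between: "\<And>c. c \<in> A \<Longrightarrow> \<not> (a < c \<and> c < b)"
    using succ by (auto simp: is_successor_suborder)
  have "A \<times> S \<inter> {(a, x)..(b, y)} = {a} \<times> (S \<inter> {x..}) \<union> {b} \<times> (S \<inter> {..y})"
    using points between by (auto simp: order.order_iff_strict)
  moreover have "{a} \<times> (S \<inter> {x..}) \<prec> {b} \<times> (S \<inter> {..y})"
    using points by (auto simp: precedes_def)
  ultimately have "separated P (A \<times> S) (a, x) (b, y) \<longleftrightarrow>
      contains_copy P ({a} \<times> (S \<inter> {x..})) \<or> contains_copy P ({b} \<times> (S \<inter> {..y}))"
    unfolding separated_def by (simp only: contains_copy_Un_iff)
  then show ?thesis
    using assms(2,3)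
    by (simp add: contains_copy_fibre contains_copy_atLeast_iff contains_copy_atMost_iff)
qed

lemma separated_lex_not_successor:
  assumes copy: "contains_copy P S"
    and points: "a \<in> A" "b \<in> A" "a < b" "\<not> is_successor (suborder A) a b"
  shows "separated P (A \<times> S) (a, x) (b, y)"
  unfolding separated_def
proof -
  obtain c where between: "c \<in> A" "a < c" "c < b" using points by (auto simp: is_successor_suborder)
  have "convex_in ({c} \<times> S) (A \<times> S \<inter> {(a, x)..(b, y)})"
    using convex_in_fibre[OF between(1)] by (rule convex_in_subset) (use between in auto)
  moreover have "contains_copy P ({c} \<times> S)" using copy by (simp add: contains_copy_fibre)
  ultimately show "contains_copy P (A \<times> S \<inter> {(a, x)..(b, y)})" by (rule contains_copy_mono)
qed

lemma separated_lex_iff: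
  assumes copy: "contains_copy P S" and mem: "a \<in> A" "b \<in> A" "x \<in> S" "y \<in> S"
  shows "separated P (A \<times> S) (a, x) (b, y) \<longleftrightarrow> a = b \<and> separated P S x y \<or>
    a < b \<and> \<not> (is_successor (suborder A) a b \<and> x \<in> upper_end P S \<and> y \<in> lower_end P S)"
proof (cases a b rule: linorder_cases)
  case less
  then show ?thesis
    using separated_lex_successor[of A a b x S y] mem
      separated_lex_not_successor[OF copy, of a A b x y] by blast
next
  case equal
  then show ?thesis using mem by (simp add: separated_lex_same)
next
  case greater
  then have "\<not> separated P (A \<times> S) (a, x) (b, y)"
    using separated_less[of "A \<times> S" "(a, x)" "(b, y)"] by auto
  then show ?thesis using greater by auto
qed

lemma mem_component_lex_iff:
  assumes copy: "contains_copy P S" and mem: "a \<in> A" "x \<in> S"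
  shows "(b, y) \<in> component P (A \<times> S) (a, x) \<longleftrightarrow> a = b \<and> y \<in> component P S x \<or>
    is_successor (suborder A) a b \<and> x \<in> upper_end P S \<and> y \<in> lower_end P S \<or>
    is_successor (suborder A) b a \<and> x \<in> lower_end P S \<and> y \<in> upper_end P S"
proof (cases "b \<in> A \<and> y \<in> S")
  case True
  then have b_mem: "b \<in> A" and y_mem: "y \<in> S" by simp_all
  have not_succ: "c < d \<Longrightarrow> \<not> is_successor (suborder A) d c" for c d
    by (auto simp: is_successor_suborder)
  have "(b, y) \<in> component P (A \<times> S) (a, x) \<longleftrightarrow>
      \<not> separated P (A \<times> S) (a, x) (b, y) \<and> \<not> separated P (A \<times> S) (b, y) (a, x)"
    using True by (simp add: component_def)
  also have "\<dots> \<longleftrightarrow> a = b \<and> \<not> separated P S x y \<and> \<not> separated P S y x \<or>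
    is_successor (suborder A) a b \<and> x \<in> upper_end P S \<and> y \<in> lower_end P S \<or>
    is_successor (suborder A) b a \<and> x \<in> lower_end P S \<and> y \<in> upper_end P S"
    unfolding separated_lex_iff[OF copy mem(1) b_mem mem(2) y_mem]
      separated_lex_iff[OF copy b_mem mem(1) y_mem mem(2)]
    using not_succ by (cases a b rule: linorder_cases) (auto simp: is_successor_suborder)
  finally show ?thesis using y_mem by (simp add: component_def)
next
  case False
  then show ?thesis
    using component_subset[of P S x] component_subset[of P "A \<times> S"] ends_subset[of P S] mem(1)
    by (auto simp: is_successor_suborder)
qed

lemma component_lex_middle:
  assumes "contains_copy P S" "a \<in> A" "x \<in> middle P S"
  shows "component P (A \<times> S) (a, x) = {a} \<times> component P S x"
  using assms mem_component_lex_iff[of S a A x] by (auto simp: middle_def)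

lemma component_lex_upper_end:
  assumes copy: "contains_copy P S" and "a \<in> A" "x \<in> upper_end P S"
  shows "component P (A \<times> S) (a, x) =
    {a} \<times> upper_end P S \<union> {b. is_successor (suborder A) a b} \<times> lower_end P S"
proof -
  have "x \<in> S" "x \<notin> lower_end P S"
    using ends_disjoint[OF copy] assms(3) by (auto simp: upper_end_def)
  then show ?thesis
    using assms mem_component_lex_iff[OF copy, of a A x] component_upper_end[OF assms(3)] by auto
qed

lemma component_lex_lower_end:
  assumes copy: "contains_copy P S" and "a \<in> A" "x \<in> lower_end P S"
  shows "component P (A \<times> S) (a, x) =
    {b. is_successor (suborder A) b a} \<times> upper_end P S \<union> {a} \<times> lower_end P S"
proof -
  have "x \<in> S" "x \<notin> upper_end P S"
    using ends_disjoint[OF copy] assms(3) by (auto simp: lower_end_def)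
  then show ?thesis
    using assms mem_component_lex_iff[OF copy, of a A x] component_lower_end[OF assms(3)] by auto
qed

lemma lower_end_lex:
  assumes copy: "contains_copy P S"
  shows "lower_end P (A \<times> S) = {a. is_left_endpoint (suborder A) a} \<times> lower_end P S"
proof -
  obtain u v where "u \<in> S" "v \<in> S" "separated P S u v" using copy by (rule separated_exists)
  then have not_upper: "u \<in> S" "u \<notin> upper_end P S" by (auto simp: upper_end_def)
  have "(a, x) \<in> lower_end P (A \<times> S) \<longleftrightarrow> (\<forall>b\<in>A. a \<le> b) \<and> x \<in> lower_end P S"
    if mem: "a \<in> A" "x \<in> S" for a x
  proof -
    have "(a, x) \<in> lower_end P (A \<times> S) \<longleftrightarrow> (\<forall>b\<in>A. \<forall>y\<in>S. \<not> (b = a \<and> separated P S y x) \<and>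
        (b < a \<longrightarrow> is_successor (suborder A) b a \<and> y \<in> upper_end P S \<and> x \<in> lower_end P S))"
      using mem by (auto simp: lower_end_def separated_lex_iff[OF copy])
    also have "\<dots> \<longleftrightarrow> (\<forall>b\<in>A. a \<le> b) \<and> x \<in> lower_end P S"
      using mem not_upper by (fastforce simp: lower_end_def)
    finally show ?thesis .
  qed
  then show ?thesis
    using ends_subset(1)[of P "A \<times> S"] ends_subset(1)[of P S]
    by (auto simp: is_left_endpoint_suborder)
qed

lemma upper_end_lex:
  assumes copy: "contains_copy P S"
  shows "upper_end P (A \<times> S) = {a. is_right_endpoint (suborder A) a} \<times> upper_end P S"
proof -
  obtain u v where "u \<in> S" "v \<in> S" "separated P S u v" using copy by (rule separated_exists)
  then have not_lower: "v \<in> S" "v \<notin> lower_end P S" by (auto simp: lower_end_def)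
  have "(a, x) \<in> upper_end P (A \<times> S) \<longleftrightarrow> (\<forall>b\<in>A. b \<le> a) \<and> x \<in> upper_end P S"
    if mem: "a \<in> A" "x \<in> S" for a x
  proof -
    have "(a, x) \<in> upper_end P (A \<times> S) \<longleftrightarrow> (\<forall>b\<in>A. \<forall>y\<in>S. \<not> (b = a \<and> separated P S x y) \<and>
        (a < b \<longrightarrow> is_successor (suborder A) a b \<and> x \<in> upper_end P S \<and> y \<in> lower_end P S))"
      using mem by (auto simp: upper_end_def separated_lex_iff[OF copy])
    also have "\<dots> \<longleftrightarrow> (\<forall>b\<in>A. b \<le> a) \<and> x \<in> upper_end P S"
      using mem not_lower by (fastforce simp: upper_end_def)
    finally show ?thesis .
  qed
  then show ?thesis
    using ends_subset(2)[of P "A \<times> S"] ends_subset(2)[of P S]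
    by (auto simp: is_right_endpoint_suborder)
qed

lemma lower_end_lex_iso_iff:
  assumes "contains_copy P S"
  shows "suborder (lower_end P (A \<times> S)) \<cong> suborder (lower_end P S) \<longleftrightarrow>
    lower_end P S = {} \<or> has_left_endpoint (suborder A)"
  unfolding lower_end_lex[OF assms] has_left_endpoint_def
  by (rule suborder_unique_fibre_iso_iff)
    (auto simp: is_left_endpoint_suborder intro: order.antisym)

lemma upper_end_lex_iso_iff:
  assumes "contains_copy P S"
  shows "suborder (upper_end P (A \<times> S)) \<cong> suborder (upper_end P S) \<longleftrightarrow>
    upper_end P S = {} \<or> has_right_endpoint (suborder A)"
  unfolding upper_end_lex[OF assms] has_right_endpoint_def
  by (rule suborder_unique_fibre_iso_iff)
    (auto simp: is_right_endpoint_suborder intro: order.antisym)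

lemma middle_lex_iff:
  assumes copy: "contains_copy P S"
  shows "(a, x) \<in> middle P (A \<times> S) \<longleftrightarrow> a \<in> A \<and> (x \<in> middle P S \<or>
    x \<in> upper_end P S \<and> \<not> is_right_endpoint (suborder A) a \<or>
    x \<in> lower_end P S \<and> \<not> is_left_endpoint (suborder A) a)"
  using ends_disjoint[OF copy] ends_subset[of P S]
  by (auto simp: middle_def lower_end_lex[OF copy] upper_end_lex[OF copy])

end

section \<open>Absorption\<close>

definition absorption_condition ::
    "'a rel \<Rightarrow> nat set \<Rightarrow> (nat \<Rightarrow> 'i rel) \<Rightarrow> 'l rel \<Rightarrow> 'r rel \<Rightarrow> bool" where
  "absorption_condition A N I L R \<longleftrightarrow>
     (L = {} \<or> has_left_endpoint A) \<and> (R = {} \<or> has_right_endpoint A) \<and>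
     ((\<exists>a b. is_successor A a b) \<longrightarrow> L = {} \<and> R = {} \<or> is_block N I (R \<^bold>+ L)) \<and>
     (all_have_predecessors A \<or> L = {} \<or> is_block N I L) \<and>
     (all_have_successors A \<or> R = {} \<or> is_block N I R)"

context component_types
begin

lemma is_block_component_lex_upper:
  assumes copy: "contains_copy P S" and mem: "a \<in> A" "x \<in> upper_end P S"
  shows "is_block N I (suborder (component P (A \<times> S) (a, x))) \<longleftrightarrow>
    (if \<exists>b. is_successor (suborder A) a b
     then is_block N I (suborder (upper_end P S) \<^bold>+ suborder (lower_end P S))
     else is_block N I (suborder (upper_end P S)))"
proof (cases "\<exists>b. is_successor (suborder A) a b")
  case True
  then obtain b where succ: "is_successor (suborder A) a b" ..
  then have "a < b" by (simp add: is_successor_suborder)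
  then show ?thesis
    using True is_block_cong[OF suborder_two_fibres_iso[OF \<open>a < b\<close>,
          of "upper_end P S" "lower_end P S"], of N I]
    by (simp add: component_lex_upper_end[OF copy mem] is_successor_suborder_unique(1)[OF succ])
next
  case False
  then show ?thesis
    using is_block_cong[OF suborder_fibre_iso[of "upper_end P S" a], of N I]
    by (simp add: component_lex_upper_end[OF copy mem])
qed

lemma is_block_component_lex_lower:
  assumes copy: "contains_copy P S" and mem: "b \<in> A" "x \<in> lower_end P S"
  shows "is_block N I (suborder (component P (A \<times> S) (b, x))) \<longleftrightarrow>
    (if \<exists>a. is_successor (suborder A) a b
     then is_block N I (suborder (upper_end P S) \<^bold>+ suborder (lower_end P S))
     else is_block N I (suborder (lower_end P S)))"
proof (cases "\<exists>a. is_successor (suborder A) a b")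
  case True
  then obtain a where succ: "is_successor (suborder A) a b" ..
  then have "a < b" by (simp add: is_successor_suborder)
  then show ?thesis
    using True is_block_cong[OF suborder_two_fibres_iso[OF \<open>a < b\<close>,
          of "upper_end P S" "lower_end P S"], of N I]
    by (simp add: component_lex_lower_end[OF copy mem] is_successor_suborder_unique(2)[OF succ])
next
  case False
  then show ?thesis
    using is_block_cong[OF suborder_fibre_iso[of "lower_end P S" b], of N I]
    by (simp add: component_lex_lower_end[OF copy mem])
qed

lemma composed_of_blocks_lex_iff:
  assumes copy: "contains_copy P S" and composed: "composed_of_blocks S"
  shows "composed_of_blocks (A \<times> S) \<longleftrightarrow>
    ((\<exists>a b. is_successor (suborder A) a b) \<longrightarrow> lower_end P S = {} \<and> upper_end P S = {} \<or>
      is_block N I (suborder (upper_end P S) \<^bold>+ suborder (lower_end P S))) \<and>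
    (all_have_predecessors (suborder A) \<or> lower_end P S = {} \<or>
      is_block N I (suborder (lower_end P S))) \<and>
    (all_have_successors (suborder A) \<or> upper_end P S = {} \<or>
      is_block N I (suborder (upper_end P S)))"
    (is "_ \<longleftrightarrow> (_ \<longrightarrow> _ \<or> ?sum_block) \<and> (_ \<or> _ \<or> ?lower_block) \<and> (_ \<or> _ \<or> ?upper_block)")
proof -
  have middle: "is_block N I (suborder (component P (A \<times> S) (a, x)))"
    if "a \<in> A" "x \<in> middle P S" for a x
    using composed that is_block_cong[OF suborder_fibre_iso, of N I "component P S x" a]
    by (simp add: component_lex_middle[OF copy] composed_of_blocks_def)
  have successor: "a \<in> A" "\<not> is_right_endpoint (suborder A) a"
      "b \<in> A" "\<not> is_left_endpoint (suborder A) b"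
    if "is_successor (suborder A) a b" for a b
    using that by (auto simp: is_successor_suborder is_right_endpoint_suborder
        is_left_endpoint_suborder not_le)
  have "composed_of_blocks (A \<times> S) \<longleftrightarrow>
      (\<forall>a\<in>A. \<not> is_right_endpoint (suborder A) a \<longrightarrow>
        (\<forall>x\<in>upper_end P S. is_block N I (suborder (component P (A \<times> S) (a, x))))) \<and>
      (\<forall>b\<in>A. \<not> is_left_endpoint (suborder A) b \<longrightarrow>
        (\<forall>x\<in>lower_end P S. is_block N I (suborder (component P (A \<times> S) (b, x)))))"
    unfolding composed_of_blocks_def using middle by (auto simp: middle_lex_iff[OF copy])
  also have "(\<forall>a\<in>A. \<not> is_right_endpoint (suborder A) a \<longrightarrow>
      (\<forall>x\<in>upper_end P S. is_block N I (suborder (component P (A \<times> S) (a, x))))) \<longleftrightarrow>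
    upper_end P S = {} \<or> ((\<exists>a b. is_successor (suborder A) a b) \<longrightarrow> ?sum_block) \<and>
      (all_have_successors (suborder A) \<or> ?upper_block)"
    using successor is_block_component_lex_upper[OF copy]
    unfolding all_have_successors_def Field_suborder by (metis ex_in_conv)
  also have "(\<forall>b\<in>A. \<not> is_left_endpoint (suborder A) b \<longrightarrow>
      (\<forall>x\<in>lower_end P S. is_block N I (suborder (component P (A \<times> S) (b, x))))) \<longleftrightarrow>
    lower_end P S = {} \<or> ((\<exists>a b. is_successor (suborder A) a b) \<longrightarrow> ?sum_block) \<and>
      (all_have_predecessors (suborder A) \<or> ?lower_block)"
    using successor is_block_component_lex_lower[OF copy]
    unfolding all_have_predecessors_def Field_suborder by (metis ex_in_conv)
  finally show ?thesis by blast
qed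

theorem absorption_iff:
  assumes order: "contains_copy P S" "countable S" "composed_of_blocks S"
    and index: "A \<noteq> {}" "countable A"
  shows "suborder (A \<times> S) \<cong> suborder S \<longleftrightarrow>
    absorption_condition (suborder A) N I (suborder (lower_end P S)) (suborder (upper_end P S))"
proof -
  have product: "contains_copy P (A \<times> S)" using index(1) order(1) by (rule contains_copy_lex)
  show ?thesis
    unfolding suborder_iso_iff_ends_iso[OF order product countable_SIGMA[OF index(2) order(2)]]
      composed_of_blocks_lex_iff[OF order(1,3)] absorption_condition_def suborder_empty_iff
      lower_end_lex_iso_iff[OF order(1)] upper_end_lex_iso_iff[OF order(1)]
    by blast
qed

end

section \<open>The components of a minimal shuffle\<close>

context doubling
begin

lemma lower_end_eqI:
  assumes cut: "S = C \<union> T" "C \<prec> T" and no_copy: "\<not> contains_copy P C"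
    and separated: "\<And>y. y \<in> T \<Longrightarrow> \<exists>x\<in>S. separated P S x y"
  shows "lower_end P S = C"
proof -
  have "\<not> separated P S y x" if "x \<in> C" "y \<in> C" for x y
    using no_copy contains_copy_convex_iff[OF convex_in_Un_left[OF cut(2)]] that cut(1) by blast
  moreover have "\<not> separated P S y x" if "x \<in> C" "y \<in> T" for x y
    using separated_less[of S y x] precedesD[OF cut(2) that] by auto
  ultimately show ?thesis using separated unfolding lower_end_def cut(1) by blast
qed

lemma upper_end_eqI:
  assumes cut: "S = T \<union> C" "T \<prec> C" and no_copy: "\<not> contains_copy P C"
    and separated: "\<And>x. x \<in> T \<Longrightarrow> \<exists>y\<in>S. separated P S x y"
  shows "upper_end P S = C"
proof -
  have "\<not> separated P S x y" if "x \<in> C" "y \<in> C" for x y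
    using no_copy contains_copy_convex_iff[OF convex_in_Un_right[OF cut(2)]] that cut(1) by blast
  moreover have "\<not> separated P S x y" if "y \<in> T" "x \<in> C" for x y
    using separated_less[of S x y] precedesD[OF cut(2) that] by auto
  ultimately show ?thesis using separated unfolding upper_end_def cut(1) by blast
qed

end

locale shuffle_blocks =
  fixes N :: "nat set" and c :: "rat \<Rightarrow> nat" and I :: "nat \<Rightarrow> 'i rel"
    and D :: "rat \<Rightarrow> 'a::linorder set" and M :: "'a set"
  assumes index_set: "index_set N"
    and partition: "dense_partition N c"
    and block_type: "\<And>q. I (c q) \<cong> suborder (D q)"
    and block_nonempty: "\<And>q. D q \<noteq> {}"
    and increasing: "\<And>p q. p < q \<Longrightarrow> D p \<prec> D q"
    and M_eq: "M = (\<Union>q. D q)"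
begin

lemma mem_M_iff: "x \<in> M \<longleftrightarrow> (\<exists>q. x \<in> D q)"
  by (simp add: M_eq)

lemma colour_mem: "c q \<in> N"
  using partition by (auto simp: dense_partition_def)

lemma interval_copy:
  assumes "p < q"
  shows "suborder M \<cong> suborder (\<Union>r\<in>{p<..<q}. D r)"
proof -
  obtain h where mono: "strict_mono_on {p<..<q} h" and image: "h ` {p<..<q} = UNIV"
    and colour: "\<And>r. r \<in> {p<..<q} \<Longrightarrow> c (h r) = c r"
  proof (rule back_and_forth)
    show "dense_unbounded_in {s \<in> UNIV. c s = c r} UNIV" for r
      using dense_partition_dense_unbounded_in[OF partition colour_mem] by simp
    fix s
    have "dense_unbounded_in ({r. c r = c s} \<inter> {p<..<q}) (UNIV \<inter> {p<..<q})"
      using dense_partition_dense_unbounded_in[OF partition colour_mem] UNIV_I UNIV_I assms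
      by (rule dense_unbounded_in_interval)
    moreover have "{r. c r = c s} \<inter> {p<..<q} = {r \<in> {p<..<q}. c s = c r}" by auto
    ultimately show "dense_unbounded_in {r \<in> {p<..<q}. c s = c r} {p<..<q}" by simp
  qed simp_all
  let ?r = "replace_points (suborder {p<..<q}) (\<lambda>r. I (c r))"
  have "?r \<cong> suborder (\<Union>r\<in>Field (suborder {p<..<q}). D r)"
    using block_type increasing by (intro replace_points_iso_suborder) auto
  moreover have "?r \<cong> suborder (\<Union>r\<in>Field (suborder {p<..<q}). D (h r))"
  proof (rule replace_points_iso_suborder)
    show "I (c r) \<cong> suborder (D (h r))" if "r \<in> Field (suborder {p<..<q})" for r
      using block_type[of "h r"] colour that by simp
    show "D (h r) \<prec> D (h s)" if "(r, s) \<in> suborder {p<..<q}" "r \<noteq> s" for r s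
      using that strict_mono_onD[OF mono] by (intro increasing) auto
  qed simp
  moreover have "(\<Union>r\<in>{p<..<q}. D (h r)) = M"
    unfolding M_eq image[symmetric] by simp
  ultimately show ?thesis
    using order_isomorphic_sym order_isomorphic_trans by (metis Field_suborder)
qed

lemma block_le: "x \<in> D p \<Longrightarrow> y \<in> D q \<Longrightarrow> x \<le> y \<Longrightarrow> p \<le> q"
  using precedesD[OF increasing] by (meson leD leI)

lemma interval_convex: "convex_in (\<Union>r\<in>{p<..<q}. D r) M"
proof (rule convex_inI)
  fix x y z assume "x \<in> (\<Union>r\<in>{p<..<q}. D r)" "y \<in> (\<Union>r\<in>{p<..<q}. D r)" "z \<in> M" "x \<le> z" "z \<le> y"
  then obtain r s t where "x \<in> D r" "y \<in> D s" "z \<in> D t" "p < r" "s < q" by (auto simp: mem_M_iff)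
  moreover from this have "r \<le> t" "t \<le> s" using block_le \<open>x \<le> z\<close> \<open>z \<le> y\<close> by blast+
  ultimately show "z \<in> (\<Union>r\<in>{p<..<q}. D r)" by auto
qed (auto simp: mem_M_iff)

lemma block_convex: "convex_in (D q) M"
proof (rule convex_inI)
  fix x y z assume ends: "x \<in> D q" "y \<in> D q" "x \<le> z" "z \<le> y" and "z \<in> M"
  then obtain r where "z \<in> D r" by (auto simp: mem_M_iff)
  moreover from this have "r = q" using block_le ends by (meson order.antisym)
  ultimately show "z \<in> D q" by simp
qed (auto simp: mem_M_iff)

sublocale doubling M
proof
  show "M \<noteq> {}" using block_nonempty mem_M_iff by blast
  have "(\<Union>r\<in>{0<..<1}. D r) \<prec> (\<Union>r\<in>{1<..<2}. D r)"
    by (auto simp: precedes_def intro: precedesD[OF increasing[OF less_trans[of _ 1]]])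
  then show "\<exists>C E. convex_in C M \<and> convex_in E M \<and> C \<prec> E \<and>
      suborder M \<cong> suborder C \<and> suborder M \<cong> suborder E"
    by (intro exI[of _ "\<Union>r\<in>{0<..<1}. D r"] exI[of _ "\<Union>r\<in>{1<..<2}. D r"] conjI
        interval_convex interval_copy) simp_all
qed

end

locale minimal_shuffle = shuffle_blocks +
  assumes block_no_copy: "\<And>q. \<not> contains_copy M (D q)"

locale minimal_shuffle_with_ends = minimal_shuffle N c I D M
  for N c and I :: "nat \<Rightarrow> 'i rel" and D and M :: "'a::linorder set" +
  fixes S Lower Upper :: "'a set"
  assumes S_eq: "S = Lower \<union> (M \<union> Upper)"
    and Lower_precedes: "Lower \<prec> M \<union> Upper" and M_precedes: "M \<prec> Upper"
    and ends_no_copy: "\<not> contains_copy M Lower" "\<not> contains_copy M Upper"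
begin

lemma M_convex: "convex_in M S"
  unfolding S_eq using convex_in_Un_left[OF M_precedes] convex_in_Un_right[OF Lower_precedes]
  by (rule convex_in_trans)

lemma contains_copy_M: "contains_copy M S"
  using M_convex by (rule contains_copyI) simp

lemma separated_blocks:
  assumes "p < q" "x \<in> D p" "y \<in> D q"
  shows "separated M S x y"
  unfolding separated_def
proof (rule contains_copyI)
  show "suborder M \<cong> suborder (\<Union>r\<in>{p<..<q}. D r)" using assms(1) by (rule interval_copy)
  have "(\<Union>r\<in>{p<..<q}. D r) \<subseteq> S \<inter> {x..y}"
    using precedesD[OF increasing] assms by (fastforce simp: S_eq mem_M_iff)
  then show "convex_in (\<Union>r\<in>{p<..<q}. D r) (S \<inter> {x..y})"
    by (rule convex_in_subset[OF convex_in_trans[OF interval_convex M_convex]]) simp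
qed

lemma separated_from_below:
  assumes "y \<in> M \<union> Upper"
  shows "\<exists>x\<in>S. separated M S x y"
proof -
  obtain z where "z \<in> M" "z \<le> y"
    using assms nonempty precedesD[OF M_precedes] less_imp_le by blast
  moreover from this obtain q x where "z \<in> D q" and x: "x \<in> D (q - 1)"
    using mem_M_iff block_nonempty by blast
  then have "separated M S x z" by (intro separated_blocks[of "q - 1" q]) simp_all
  moreover have "x \<in> S" using x by (auto simp: S_eq mem_M_iff)
  ultimately show ?thesis using separated_mono by blast
qed

lemma separated_from_above:
  assumes "x \<in> Lower \<union> M"
  shows "\<exists>y\<in>S. separated M S x y"
proof -
  obtain z where "z \<in> M" "x \<le> z"
    using assms nonempty precedesD[OF Lower_precedes] less_imp_le by blast
  moreover from this obtain q y where "z \<in> D q" and y: "y \<in> D (q + 1)"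
    using mem_M_iff block_nonempty by blast
  then have "separated M S z y" by (intro separated_blocks[of q "q + 1"]) simp_all
  moreover have "y \<in> S" using y by (auto simp: S_eq mem_M_iff)
  ultimately show ?thesis using separated_mono by blast
qed

lemma lower_end_eq: "lower_end M S = Lower"
  using S_eq Lower_precedes ends_no_copy(1) separated_from_below by (rule lower_end_eqI)

lemma upper_end_eq: "upper_end M S = Upper"
proof (rule upper_end_eqI)
  show "S = (Lower \<union> M) \<union> Upper" by (simp add: S_eq Un_assoc)
  show "Lower \<union> M \<prec> Upper" using Lower_precedes M_precedes by (auto simp: precedes_def)
qed (use ends_no_copy(2) separated_from_above in auto)

lemma middle_eq: "middle M S = M"
  unfolding middle_def lower_end_eq upper_end_eq
  using S_eq precedes_disjoint[OF Lower_precedes] precedes_disjoint[OF M_precedes] by blast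

lemma component_eq_block:
  assumes x_mem: "x \<in> D q"
  shows "component M S x = D q"
proof (intro equalityI subsetI)
  fix y assume y_mem: "y \<in> component M S x"
  have "x \<in> middle M S" using x_mem by (auto simp: middle_eq mem_M_iff)
  then have "y \<in> M" using y_mem middle_component middle_eq by blast
  then obtain r where block: "y \<in> D r" by (auto simp: mem_M_iff)
  have "\<not> q < r" "\<not> r < q" using y_mem separated_blocks x_mem block by (auto simp: component_def)
  then show "y \<in> D q" using block by (metis linorder_neqE)
next
  fix y assume y_mem: "y \<in> D q"
  have "convex_in (D q) S" using block_convex M_convex by (rule convex_in_trans)
  then show "y \<in> component M S x"
    using contains_copy_convex_iff block_no_copy x_mem y_mem
    by (auto simp: component_def S_eq mem_M_iff)
qed

end

sublocale minimal_shuffle \<subseteq> component_types M N I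
proof
  interpret inner: minimal_shuffle_with_ends N c I D M M "{}" "{}"
    by unfold_locales (auto simp: precedes_def contains_copy_empty_iff nonempty)
  show "index_set N" by (rule index_set)
  fix k assume "k \<in> N"
  then obtain q where colour: "c q = k"
    using dense_partition_dense_unbounded_in[OF partition] unfolding dense_unbounded_in_def by blast
  obtain w where w_mem: "w \<in> D q" using block_nonempty by blast
  then have "w \<in> middle M M" by (auto simp: inner.middle_eq mem_M_iff)
  moreover have "I k \<cong> suborder (component M M w)"
    using inner.component_eq_block[OF w_mem] block_type[of q] colour by simp
  ultimately show "\<exists>w\<in>middle M M. I k \<cong> suborder (component M M w)" by blast
qed

context minimal_shuffle_with_ends
begin

lemma composed_of_blocks_S: "composed_of_blocks S"
  unfolding composed_of_blocks_def is_block_def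
proof
  fix x assume "x \<in> middle M S"
  then obtain q where "x \<in> D q" by (auto simp: middle_eq mem_M_iff)
  then show "\<exists>k\<in>N. suborder (component M S x) \<cong> I k"
    using order_isomorphic_sym[OF block_type] colour_mem component_eq_block by metis
qed

lemma absorption_iff_ends:
  assumes "countable S" "A \<noteq> {}" "countable A"
  shows "suborder (A \<times> S) \<cong> suborder S \<longleftrightarrow>
    absorption_condition (suborder A) N I (suborder Lower) (suborder Upper)"
  using absorption_iff[OF contains_copy_M assms(1) composed_of_blocks_S assms(2,3)]
  unfolding lower_end_eq upper_end_eq .

end

section \<open>Invariance of endpoints and successors\<close>

lemma endpoints_bounded_iff:
  shows "has_left_endpoint A \<longleftrightarrow> (\<exists>a\<in>Field A. is_left_endpoint A a)"
    and "has_right_endpoint A \<longleftrightarrow> (\<exists>a\<in>Field A. is_right_endpoint A a)"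
  by (auto simp: has_left_endpoint_def has_right_endpoint_def is_left_endpoint_def
      is_right_endpoint_def)

lemma is_successor_mem_Field: "is_successor A a b \<Longrightarrow> a \<in> Field A" "is_successor A a b \<Longrightarrow> b \<in> Field A"
  by (auto simp: is_successor_def Field_def)

lemma successors_bounded_iff:
  shows "(\<exists>a b. is_successor A a b) \<longleftrightarrow> (\<exists>a\<in>Field A. \<exists>b\<in>Field A. is_successor A a b)"
    and "all_have_successors A \<longleftrightarrow>
      (\<forall>a\<in>Field A. \<not> is_right_endpoint A a \<longrightarrow> (\<exists>b\<in>Field A. is_successor A a b))"
    and "all_have_predecessors A \<longleftrightarrow>
      (\<forall>a\<in>Field A. \<not> is_left_endpoint A a \<longrightarrow> (\<exists>b\<in>Field A. is_successor A b a))"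
  unfolding all_have_successors_def all_have_predecessors_def
  using is_successor_mem_Field by meson+

lemma is_successor_bounded_iff:
  "is_successor A a b \<longleftrightarrow> (a, b) \<in> A \<and> a \<noteq> b \<and>
    (\<forall>z\<in>Field A. (a, z) \<in> A \<and> (z, b) \<in> A \<longrightarrow> z = a \<or> z = b)"
  unfolding is_successor_def by (meson FieldI2)

lemma endpoint_properties_iso:
  assumes "A \<cong> B"
  shows "has_left_endpoint A \<longleftrightarrow> has_left_endpoint B"
    and "has_right_endpoint A \<longleftrightarrow> has_right_endpoint B"
    and "(\<exists>a b. is_successor A a b) \<longleftrightarrow> (\<exists>a b. is_successor B a b)"
    and "all_have_successors A \<longleftrightarrow> all_have_successors B"
    and "all_have_predecessors A \<longleftrightarrow> all_have_predecessors B"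
proof -
  obtain f where bij: "bij_betw f (Field A) (Field B)"
    and order: "\<And>a b. a \<in> Field A \<Longrightarrow> b \<in> Field A \<Longrightarrow> (a, b) \<in> A \<longleftrightarrow> (f a, f b) \<in> B"
    using assms by (rule order_isomorphicE) blast
  have image: "Field B = f ` Field A" and inj: "\<And>a b. a \<in> Field A \<Longrightarrow> b \<in> Field A \<Longrightarrow> f a = f b \<longleftrightarrow> a = b"
    using bij by (auto simp: bij_betw_def inj_on_eq_iff)
  have left: "is_left_endpoint B (f a) \<longleftrightarrow> is_left_endpoint A a"
    and right: "is_right_endpoint B (f a) \<longleftrightarrow> is_right_endpoint A a" if "a \<in> Field A" for a
    using that order by (auto simp: is_left_endpoint_def is_right_endpoint_def image)
  have succ: "is_successor B (f a) (f b) \<longleftrightarrow> is_successor A a b"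
    if "a \<in> Field A" "b \<in> Field A" for a b
    using that order inj by (simp add: is_successor_bounded_iff image)
  show "has_left_endpoint A \<longleftrightarrow> has_left_endpoint B" "has_right_endpoint A \<longleftrightarrow> has_right_endpoint B"
    using left right by (simp_all add: endpoints_bounded_iff image)
  show "(\<exists>a b. is_successor A a b) \<longleftrightarrow> (\<exists>a b. is_successor B a b)"
    "all_have_successors A \<longleftrightarrow> all_have_successors B"
    "all_have_predecessors A \<longleftrightarrow> all_have_predecessors B"
    using left right succ by (simp_all add: successors_bounded_iff image)
qed

lemma absorption_condition_cong:
  assumes "A \<cong> A'" "L \<cong> L'" "R \<cong> R'"
  shows "absorption_condition A N I L R \<longleftrightarrow> absorption_condition A' N I L' R'"
  unfolding absorption_condition_def endpoint_properties_iso[OF assms(1)]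
    order_isomorphic_empty_iff[OF assms(2)] order_isomorphic_empty_iff[OF assms(3)]
    is_block_cong[OF assms(2)] is_block_cong[OF assms(3)]
    is_block_cong[OF order_sum_cong[OF assms(3,2)]] ..

section \<open>The eight conditions\<close>

definition admissible_ends :: "nat set \<Rightarrow> (nat \<Rightarrow> 'i rel) \<Rightarrow> 'l rel \<Rightarrow> 'r rel \<Rightarrow> bool" where
  "admissible_ends N I L R \<longleftrightarrow>
     is_block N I (R \<^bold>+ L) \<or> (L = {} \<or> is_block N I L) \<and> (R = {} \<or> is_block N I R)"

lemma not_is_block_empty: "\<forall>k\<in>N. I k \<noteq> {} \<Longrightarrow> \<not> is_block N I {}"
  unfolding is_block_def using order_isomorphic_empty_iff by blast

lemma is_block_empty_left_end:
  assumes "\<forall>k\<in>N. I k \<noteq> {}" and "L = {}"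
  shows "\<not> is_block N I L \<and> (is_block N I (R \<^bold>+ L) \<longleftrightarrow> is_block N I R)"
  using assms not_is_block_empty is_block_cong[OF order_sum_empty_right[of R]] by blast

lemma is_block_empty_right_end:
  assumes "\<forall>k\<in>N. I k \<noteq> {}" and "R = {}"
  shows "\<not> is_block N I R \<and> (is_block N I (R \<^bold>+ L) \<longleftrightarrow> is_block N I L)"
  using assms not_is_block_empty is_block_cong[OF order_sum_empty_left[of L]] by blast

lemma end_condition_iff_is_block:
  "end_condition C1 N I L R \<longleftrightarrow> L = {} \<and> R = {}"
  "end_condition C2 N I L R \<longleftrightarrow> is_block N I L \<and> R = {}"
  "end_condition C3 N I L R \<longleftrightarrow> is_block N I R \<and> L = {}"
  "end_condition C4 N I L R \<longleftrightarrow> is_block N I L \<and> is_block N I R \<and> \<not> is_block N I (R \<^bold>+ L)"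
  "end_condition C5 N I L R \<longleftrightarrow> is_block N I (R \<^bold>+ L) \<and> \<not> is_block N I L \<and> \<not> is_block N I R"
  "end_condition C6 N I L R \<longleftrightarrow>
    is_block N I (R \<^bold>+ L) \<and> is_block N I L \<and> \<not> is_block N I R \<and> R \<noteq> {}"
  "end_condition C7 N I L R \<longleftrightarrow>
    is_block N I (R \<^bold>+ L) \<and> is_block N I R \<and> \<not> is_block N I L \<and> L \<noteq> {}"
  "end_condition C8 N I L R \<longleftrightarrow> is_block N I (R \<^bold>+ L) \<and> is_block N I L \<and> is_block N I R"
  by (auto simp: is_block_def)

lemma end_condition_ex1_iff:
  assumes "\<forall>k\<in>N. I k \<noteq> {}"
  shows "(\<exists>!t. end_condition t N I L R) \<longleftrightarrow> admissible_ends N I L R"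
proof -
  note empty_ends =
    is_block_empty_left_end[OF assms, of L R] is_block_empty_right_end[OF assms, of R L]
  have exclusive: "t = t'" if "end_condition t N I L R" "end_condition t' N I L R" for t t'
    using that empty_ends
    by (cases t; cases t'; simp only: end_condition_iff_is_block end_type.distinct simp_thms; argo)
  have "(\<exists>t. end_condition t N I L R) \<longleftrightarrow>
      end_condition C1 N I L R \<or> end_condition C2 N I L R \<or> end_condition C3 N I L R \<or>
      end_condition C4 N I L R \<or> end_condition C5 N I L R \<or> end_condition C6 N I L R \<or>
      end_condition C7 N I L R \<or> end_condition C8 N I L R"
    by (metis end_type.exhaust)
  also have "\<dots> \<longleftrightarrow> admissible_ends N I L R"
    unfolding end_condition_iff_is_block admissible_ends_def using empty_ends by argo
  finally show ?thesis using exclusive by blast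
qed

lemma absorption_condition_two_points_iff:
  fixes a b :: "'a::linorder"
  assumes "a < b"
  shows "absorption_condition (suborder {a, b}) N I L R \<longleftrightarrow> L = {} \<and> R = {} \<or> is_block N I (R \<^bold>+ L)"
proof -
  have "is_left_endpoint (suborder {a, b}) a" "is_right_endpoint (suborder {a, b}) b"
    "is_successor (suborder {a, b}) a b"
    using assms
    by (auto simp: is_left_endpoint_suborder is_right_endpoint_suborder is_successor_suborder)
  then have "has_left_endpoint (suborder {a, b})" "has_right_endpoint (suborder {a, b})"
    "\<exists>x y. is_successor (suborder {a, b}) x y"
    "all_have_successors (suborder {a, b})" "all_have_predecessors (suborder {a, b})"
    unfolding has_left_endpoint_def has_right_endpoint_def all_have_successors_def
      all_have_predecessors_def by (simp_all, blast+)
  then show ?thesis unfolding absorption_condition_def by blast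
qed

lemma no_successors_interval: "\<not> is_successor (suborder {a..b}) x y"
  for a b :: "'a::dense_linorder"
proof
  assume succ: "is_successor (suborder {a..b}) x y"
  then obtain z where "x < z" "z < y" using dense[of x y] by (auto simp: is_successor_suborder)
  then show False using succ by (force simp: is_successor_suborder)
qed

lemma has_endpoints_interval:
  fixes a b :: "'a::linorder"
  assumes "a \<le> b"
  shows "has_left_endpoint (suborder {a..b})" "has_right_endpoint (suborder {a..b})"
  using assms unfolding endpoints_bounded_iff
  by (auto simp: is_left_endpoint_suborder is_right_endpoint_suborder
      intro: bexI[of _ a] bexI[of _ b])

lemma absorption_condition_interval:
  fixes a b :: "'a::dense_linorder"
  assumes "a \<le> b" "L = {} \<or> is_block N I L" "R = {} \<or> is_block N I R"
  shows "absorption_condition (suborder {a..b}) N I L R"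
  using assms no_successors_interval has_endpoints_interval unfolding absorption_condition_def
  by blast

lemma absorption_condition_imp_admissible_ends:
  assumes condition: "absorption_condition (suborder A) N I L R" and points: "a \<in> A" "b \<in> A" "a < b"
  shows "admissible_ends N I L R"
proof (cases "\<exists>x y. is_successor (suborder A) x y")
  case True
  then show ?thesis using condition unfolding absorption_condition_def admissible_ends_def by blast
next
  case False
  have "\<not> is_left_endpoint (suborder A) b" "\<not> is_right_endpoint (suborder A) a"
    using points by (auto simp: is_left_endpoint_suborder is_right_endpoint_suborder not_le)
  then have "\<not> all_have_predecessors (suborder A)" "\<not> all_have_successors (suborder A)"
    using points False by (auto simp: all_have_predecessors_def all_have_successors_def)
  then show ?thesis using condition unfolding absorption_condition_def admissible_ends_def by blast
qed

section \<open>Absorption for a given representation\<close>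

lemma shuffle_iso_suborderE:
  assumes index: "index_set N" and blocks: "\<And>k. k \<in> N \<Longrightarrow> countable_order (I k) \<and> I k \<noteq> {}"
    and copy: "shuffle N I \<cong> suborder M"
  obtains c D where "shuffle_blocks N c I D M"
proof -
  obtain c where partition: "dense_partition N c"
    and shuffle: "shuffle N I = replace_points (suborder UNIV) (\<lambda>q. I (c q))"
    using index by (rule shuffle_eq_replace_pointsE)
  then have colour: "c q \<in> N" for q by (auto simp: dense_partition_def)
  then have Refl: "Refl (I (c q))" for q
    using blocks by (simp add: countable_order_def order_on_defs)
  obtain D where decomposition: "M = (\<Union>q. D q)" "\<And>q. I (c q) \<cong> suborder (D q)"
    "\<And>p q. p < q \<Longrightarrow> D p \<prec> D q"
    using copy unfolding shuffle by (rule replace_points_iso_suborderE) (auto simp: Refl)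
  have "D q \<noteq> {}" for q
    using order_isomorphic_empty_iff[OF decomposition(2)[of q]] blocks[OF colour] by simp
  then have "shuffle_blocks N c I D M" using index partition decomposition by unfold_locales
  then show thesis by (rule that)
qed

context shuffle_blocks
begin

lemma is_block_no_copy:
  assumes minimal: "minimal_collection N I" and copy: "shuffle N I \<cong> suborder M"
    and block: "is_block N I r" "r \<cong> suborder K"
  shows "\<not> contains_copy M K"
proof -
  obtain k where index: "k \<in> N" "r \<cong> I k" using block(1) by (auto simp: is_block_def)
  have "I k \<cong> suborder K"
    using order_isomorphic_sym[OF index(2)] block(2) by (rule order_isomorphic_trans)
  then have "has_convex_copy (I k) (shuffle N I) \<longleftrightarrow> contains_copy M K"
    using copy by (rule has_convex_copy_iff_contains_copy)
  then show ?thesis using minimal index(1) by (simp add: minimal_collection_def)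
qed

lemma admissible_ends_no_copy:
  fixes Lower Upper :: "'b::linorder set"
  assumes minimal: "minimal_collection N I" and copy: "shuffle N I \<cong> suborder M"
    and lower: "L \<cong> suborder Lower" and upper: "R \<cong> suborder Upper"
    and ends: "admissible_ends N I L R"
  shows "\<not> contains_copy M Lower" "\<not> contains_copy M Upper"
proof -
  note no_copy = is_block_no_copy[OF minimal copy]
  have lower_empty: "\<not> contains_copy M Lower" if "L = {}"
    using that order_isomorphic_empty_iff[OF lower] nonempty by (simp add: contains_copy_empty_iff)
  have upper_empty: "\<not> contains_copy M Upper" if "R = {}"
    using that order_isomorphic_empty_iff[OF upper] nonempty by (simp add: contains_copy_empty_iff)
  have "\<not> contains_copy M Lower \<and> \<not> contains_copy M Upper"
  proof (cases "is_block N I (R \<^bold>+ L)")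
    case True
    let ?K = "{0 :: nat} \<times> Upper \<union> {1} \<times> Lower"
    have "R \<^bold>+ L \<cong> suborder Upper \<^bold>+ suborder Lower" using upper lower by (rule order_sum_cong)
    also have "\<dots> \<cong> suborder ?K" by (rule suborder_two_fibres_iso) simp
    finally have "\<not> contains_copy M ?K" using no_copy True by blast
    moreover have "{0 :: nat} \<times> Upper \<prec> {1} \<times> Lower" by (simp add: precedes_def)
    ultimately show ?thesis by (simp add: contains_copy_Un_iff contains_copy_fibre)
  next
    case False
    then show ?thesis
      using ends no_copy[OF _ lower] no_copy[OF _ upper] lower_empty upper_empty
      unfolding admissible_ends_def by blast
  qed
  then show "\<not> contains_copy M Lower" "\<not> contains_copy M Upper" by simp_all
qed

end

lemma shuffle_representation_nonempty: "shuffle_representation X N I L R \<Longrightarrow> \<forall>k\<in>N. I k \<noteq> {}"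
  by (simp add: shuffle_representation_def)

lemma shuffle_representation_admissible_ends:
  "shuffle_representation X N I L R \<Longrightarrow> \<exists>!t. end_condition t N I L R \<Longrightarrow> admissible_ends N I L R"
  by (rule iffD1[OF end_condition_ex1_iff[OF shuffle_representation_nonempty]])

lemma shuffle_representationE:
  fixes I :: "nat \<Rightarrow> 'i rel"
  assumes order: "countable_order X" and rep: "shuffle_representation X N I L R"
    and ends: "admissible_ends N I L R"
  obtains c D and S Lower M Upper :: "real set"
  where "minimal_shuffle_with_ends N c I D M S Lower Upper" "countable S" "X \<cong> suborder S"
    "L \<cong> suborder Lower" "R \<cong> suborder Upper"
proof -
  have index: "index_set N" and countable_blocks: "\<And>k. k \<in> N \<Longrightarrow> countable_order (I k) \<and> I k \<noteq> {}"
    and minimal: "minimal_collection N I" and X_iso: "X \<cong> L \<^bold>+ shuffle N I \<^bold>+ R"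
    using rep by (auto simp: shuffle_representation_def)
  obtain S :: "real set" where real_copy: "countable S" "X \<cong> suborder S"
    using order by (rule countable_order_iso_real_suborderE)
  have "L \<^bold>+ shuffle N I \<^bold>+ R \<cong> suborder S"
    using order_isomorphic_sym[OF X_iso] real_copy(2) by (rule order_isomorphic_trans)
  then obtain Lower T where lower: "S = Lower \<union> T" "Lower \<prec> T" "L \<cong> suborder Lower"
    and rest: "shuffle N I \<^bold>+ R \<cong> suborder T"
    by (rule order_sum_iso_suborderE)
  obtain M Upper where upper: "T = M \<union> Upper" "M \<prec> Upper" "R \<cong> suborder Upper"
    and middle: "shuffle N I \<cong> suborder M"
    using rest by (rule order_sum_iso_suborderE)
  obtain c D where blocks: "shuffle_blocks N c I D M"
    using index countable_blocks middle by (rule shuffle_iso_suborderE)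
  interpret shuffle_blocks N c I D M by (rule blocks)
  have "is_block N I (I (c q))" for q
    unfolding is_block_def using colour_mem order_isomorphic_refl by blast
  then have "\<not> contains_copy M (D q)" for q
    using is_block_no_copy[OF minimal middle] block_type by blast
  moreover note admissible_ends_no_copy[OF minimal middle lower(3) upper(3) ends]
  ultimately have "minimal_shuffle_with_ends N c I D M S Lower Upper"
    using lower upper by unfold_locales auto
  then show thesis using real_copy lower(3) upper(3) by (rule that)
qed

theorem absorption_iff_absorption_condition:
  assumes order: "countable_order X" "X \<noteq> {}" and rep: "shuffle_representation X N I L R"
    and ends: "admissible_ends N I L R" and index: "countable_order A"
  shows "A \<^bold>* X \<cong> X \<longleftrightarrow> A \<noteq> {} \<and> absorption_condition A N I L R"
proof (cases "A = {}")
  case True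
  then have "A \<^bold>* X = {}" by (simp add: lex_product_def replace_points_def)
  then show ?thesis using True order(2) order_isomorphic_empty_iff[of "A \<^bold>* X" X] by auto
next
  case False
  obtain c D and S Lower M Upper :: "real set"
    where shuffle: "minimal_shuffle_with_ends N c I D M S Lower Upper"
    and real_copy: "countable S" "X \<cong> suborder S"
    and end_copies: "L \<cong> suborder Lower" "R \<cong> suborder Upper"
    using order(1) rep ends by (rule shuffle_representationE)
  obtain B :: "real set" where index_copy: "countable B" "A \<cong> suborder B"
    using index by (rule countable_order_iso_real_suborderE)
  have "A \<^bold>* X \<cong> suborder (B \<times> S)"
    using index index_copy(2) real_copy(2)
    by (intro lex_product_iso_suborder) (simp_all add: countable_order_def)
  then have "A \<^bold>* X \<cong> X \<longleftrightarrow> suborder (B \<times> S) \<cong> suborder S"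
    using real_copy(2) by (rule order_isomorphic_cong)
  also have "\<dots> \<longleftrightarrow> absorption_condition (suborder B) N I (suborder Lower) (suborder Upper)"
    using shuffle real_copy(1) _ index_copy(1)
  proof (rule minimal_shuffle_with_ends.absorption_iff_ends)
    show "B \<noteq> {}" using False order_isomorphic_empty_iff[OF index_copy(2)] by simp
  qed
  also have "\<dots> \<longleftrightarrow> absorption_condition A N I L R"
    using index_copy(2) end_copies by (rule absorption_condition_cong[symmetric])
  finally show ?thesis using False by simp
qed

lemma left_absorbing_of_representation:
  assumes order: "countable_order X" "X \<noteq> {}" and rep: "shuffle_representation X N I L R"
    and ends: "admissible_ends N I L R"
  shows "left_absorbing X"
proof -
  have "absorption_condition (suborder {0, 1 :: rat}) N I L R \<or>
      absorption_condition (suborder {0..1 :: rat}) N I L R"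
    using ends absorption_condition_two_points_iff[of "0 :: rat" 1 N I L R]
      absorption_condition_interval[of "0 :: rat" 1 L N I R]
    unfolding admissible_ends_def by auto
  then obtain A :: "rat set" where "absorption_condition (suborder A) N I L R"
    and mem: "0 \<in> A" "1 \<in> A"
    by (metis atLeastAtMost_iff insertI1 insertI2 order_refl zero_le_one)
  then have "suborder A \<^bold>* X \<cong> X"
    using absorption_iff_absorption_condition[OF order rep ends, of "suborder A"] by auto
  then show ?thesis
    using order mem
    by (intro left_absorbingI[of "suborder A" 0 1]) (simp_all add: countable_order_def)
qed

section \<open>Existence of a representation\<close>

lemma lex_product_iso_countable_index:
  assumes iso: "A \<^bold>* X \<cong> X" and fibre: "Refl X" "X \<noteq> {}" "countable (Field X)"
  shows "countable (Field A)"
proof -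
  obtain x where x_mem: "x \<in> Field X" using fibre(2) Field_empty_iff[of X] by auto
  have Field: "Field (A \<^bold>* X) = Field A \<times> Field X"
    unfolding lex_product_def using fibre(1) by (simp add: Field_replace_points)
  obtain f where bij: "bij_betw f (Field A \<times> Field X) (Field X)"
    using iso by (rule order_isomorphicE) (simp add: Field)
  have "inj_on (\<lambda>a. f (a, x)) (Field A)" "(\<lambda>a. f (a, x)) ` Field A \<subseteq> Field X"
    using bij x_mem by (auto simp: bij_betw_def inj_on_def)
  then show ?thesis using fibre(3) by (meson countable_image_inj_on countable_subset)
qed

lemma left_absorbing_iso_real_suborderE:
  fixes X :: "'x rel"
  assumes order: "countable_order X" "X \<noteq> {}" and "left_absorbing X"
  obtains A S :: "real set" and a b
  where "countable A" "countable S" "S \<noteq> {}" "X \<cong> suborder S" "suborder (A \<times> S) \<cong> suborder S"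
    "a \<in> A" "b \<in> A" "a < b"
proof -
  obtain B :: "'x rel" and u v where absorbed: "Linear_order B" "B \<^bold>* X \<cong> X"
    and points: "u \<in> Field B" "v \<in> Field B" "u \<noteq> v"
    using assms(3) unfolding left_absorbing_def by blast
  have "countable (Field B)"
    using lex_product_iso_countable_index[OF absorbed(2)] order
    by (simp add: countable_order_def order_on_defs)
  then have "countable_order B" using absorbed(1) by (simp add: countable_order_def)
  then obtain A :: "real set" where index_copy: "countable A" "B \<cong> suborder A"
    by (rule countable_order_iso_real_suborderE)
  obtain S :: "real set" where real_copy: "countable S" "X \<cong> suborder S"
    using order(1) by (rule countable_order_iso_real_suborderE)
  have "suborder (A \<times> S) \<cong> B \<^bold>* X"
    using absorbed(1) index_copy(2) real_copy(2)
    by (intro order_isomorphic_sym[OF lex_product_iso_suborder])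
  also note absorbed(2)
  also note real_copy(2)
  finally have "suborder (A \<times> S) \<cong> suborder S" .
  moreover have "S \<noteq> {}" using order(2) order_isomorphic_empty_iff[OF real_copy(2)] by simp
  moreover obtain a b where "a \<in> A" "b \<in> A" "a < b"
  proof -
    obtain f where bij: "bij_betw f (Field B) A" using index_copy(2) by (rule iso_suborderE)
    have "f u \<in> A" "f v \<in> A" using bij_betwE[OF bij] points by blast+
    moreover have "f u \<noteq> f v" using bij_betw_imp_inj_on[OF bij] points by (simp add: inj_on_eq_iff)
    ultimately show thesis using that by (metis linorder_neqE)
  qed
  ultimately show thesis using that index_copy(1) real_copy by blast
qed

lemma doubling_of_absorption:
  assumes iso: "suborder (A \<times> S) \<cong> suborder S" and "S \<noteq> {}" and points: "a \<in> A" "b \<in> A" "a < b"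
  shows "doubling S"
proof
  obtain f where mono: "strict_mono_on (A \<times> S) f" and image: "f ` (A \<times> S) = S"
    using iso by (rule suborder_isoE)
  have copy: "convex_in (f ` ({a} \<times> S)) S" "suborder S \<cong> suborder (f ` ({a} \<times> S))" if "a \<in> A" for a
  proof -
    show "convex_in (f ` ({a} \<times> S)) S"
      using convex_in_image[OF mono convex_in_fibre[OF that]] image by simp
    have "{a} \<times> S \<subseteq> A \<times> S" using that by blast
    then have "suborder ({a} \<times> S) \<cong> suborder (f ` ({a} \<times> S))"
      by (rule strict_mono_on_subset_image_iso[OF mono])
    with suborder_fibre_iso show "suborder S \<cong> suborder (f ` ({a} \<times> S))"
      by (rule order_isomorphic_trans)
  qed
  have "f ` ({a} \<times> S) \<prec> f ` ({b} \<times> S)"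
    using points by (auto simp: precedes_def intro!: strict_mono_onD[OF mono])
  then show "\<exists>C D. convex_in C S \<and> convex_in D S \<and> C \<prec> D \<and>
      suborder S \<cong> suborder C \<and> suborder S \<cong> suborder D"
    using copy[OF points(1)] copy[OF points(2)] by blast
qed (rule \<open>S \<noteq> {}\<close>)

lemma (in doubling) contains_copy_middle:
  assumes "contains_copy P S"
  shows "contains_copy P (middle P S)"
proof -
  obtain u v where outer: "u \<in> S" "v \<in> S" "separated P S u v" using assms by (rule separated_exists)
  obtain x where lower_point: "x \<in> S" "separated P S u x" "separated P S x v"
    using outer(3) by (rule separated_dense)
  obtain y where upper_point: "y \<in> S" "separated P S x y" "separated P S y v"
    using lower_point(3) by (rule separated_dense)
  have "separated P S u z \<and> separated P S z v" if "x \<le> z" "z \<le> y" for z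
    using that separated_mono[OF lower_point(2) order_refl]
      separated_mono[OF upper_point(3) _ order_refl] by blast
  then have "S \<inter> {x..y} \<subseteq> middle P S"
    using outer(1,2) unfolding subset_iff middle_iff Int_iff atLeastAtMost_iff by blast
  then have "convex_in (S \<inter> {x..y}) (middle P S)"
    using middle_subset by (rule convex_in_subset[OF convex_in_interval(1)])
  then show ?thesis using upper_point(2) unfolding separated_def by (rule contains_copy_mono)
qed

lemma (in doubling) component_types_nat_relE:
  assumes "countable P"
  obtains I :: "nat \<Rightarrow> nat rel" where "\<And>k. countable_order (I k) \<and> I k \<noteq> {}"
    "component_types P UNIV I" "component_types.composed_of_blocks P UNIV I P"
proof -
  have middle: "middle P P \<noteq> {}" "countable (middle P P)"
    using contains_copy_middle[OF contains_copy_refl] nonempty middle_subset[of P P] assms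
    by (auto simp: contains_copy_empty_iff intro: countable_subset)
  let ?w = "from_nat_into (middle P P)"
  have mem: "?w k \<in> middle P P" for k using middle(1) by (rule from_nat_into)
  have "\<exists>s :: nat rel. countable_order s \<and> s \<cong> suborder (component P P (?w k))" for k
    using component_subset[of P P] assms
    by (metis countable_order_iso_nat_relE countable_order_suborder_iff countable_subset)
  then obtain I :: "nat \<Rightarrow> nat rel"
    where types: "\<And>k. countable_order (I k)" "\<And>k. I k \<cong> suborder (component P P (?w k))"
    by metis
  interpret component_types P UNIV I
    by unfold_locales (use types(2) mem in \<open>auto simp: index_set_def\<close>)
  show thesis
  proof
    have "component P P (?w k) \<noteq> {}" for k using component_self mem middle_subset by blast
    then show "countable_order (I k) \<and> I k \<noteq> {}" for k
      using types(1) order_isomorphic_empty_iff[OF types(2)] by simp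
    show "component_types P UNIV I" by unfold_locales
    show "composed_of_blocks P"
      unfolding composed_of_blocks_def is_block_def
      using from_nat_into_surj[OF middle(2)] order_isomorphic_sym[OF types(2)] by (metis UNIV_I)
  qed
qed

lemma (in component_types) minimal_collection:
  assumes "countable P" "composed_of_blocks P"
  shows "minimal_collection N I"
  unfolding minimal_collection_def
proof
  fix k assume "k \<in> N"
  then obtain w where "I k \<cong> suborder (component P P w)" using types_occur by blast
  then have "has_convex_copy (I k) (shuffle N I) \<longleftrightarrow> contains_copy (middle P P) (component P P w)"
    using shuffle_iso_middle[OF contains_copy_refl assms]
    by (rule has_convex_copy_iff_contains_copy)
  then show "\<not> has_convex_copy (I k) (shuffle N I)"
    using contains_copy_trans[OF contains_copy_middle[OF contains_copy_refl]] component_no_copy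
    by blast
qed

theorem left_absorbing_representation:
  assumes "countable_order X" "X \<noteq> {}" and "left_absorbing X"
  obtains I :: "nat \<Rightarrow> nat rel" and L R :: "nat rel"
  where "shuffle_representation X UNIV I L R" "admissible_ends UNIV I L R"
proof -
  obtain A S :: "real set" and a b where countable: "countable A" "countable S" and "S \<noteq> {}"
    and X_iso: "X \<cong> suborder S" and absorbs: "suborder (A \<times> S) \<cong> suborder S"
    and points: "a \<in> A" "b \<in> A" "a < b"
    using assms by (rule left_absorbing_iso_real_suborderE)
  interpret doubling S using absorbs \<open>S \<noteq> {}\<close> points by (rule doubling_of_absorption)
  obtain I :: "nat \<Rightarrow> nat rel" where blocks: "\<And>k. countable_order (I k) \<and> I k \<noteq> {}"
    and types: "component_types S UNIV I"
    and composed: "component_types.composed_of_blocks S UNIV I S"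
    using countable(2) by (rule component_types_nat_relE) blast
  interpret component_types S UNIV I by (rule types)
  have ends_countable: "countable (lower_end S S)" "countable (upper_end S S)"
    using ends_subset[of S S] countable(2) by (auto intro: countable_subset)
  obtain L :: "nat rel" where left_end: "countable_order L" "L \<cong> suborder (lower_end S S)"
    using countable_order_iso_nat_relE ends_countable(1) countable_order_suborder_iff by metis
  obtain R :: "nat rel" where right_end: "countable_order R" "R \<cong> suborder (upper_end S S)"
    using countable_order_iso_nat_relE ends_countable(2) countable_order_suborder_iff by metis
  note X_iso
  also have "suborder S \<cong> suborder (lower_end S S) \<^bold>+ shuffle UNIV I \<^bold>+ suborder (upper_end S S)"
    using contains_copy_refl countable(2) composed by (rule shuffle_decomposition)
  also have "\<dots> \<cong> L \<^bold>+ shuffle UNIV I \<^bold>+ R"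
    using left_end(2) right_end(2)
    by (intro order_sum_cong order_isomorphic_refl) (erule order_isomorphic_sym)+
  finally have "shuffle_representation X UNIV I L R"
    unfolding shuffle_representation_def
    using index_set blocks left_end(1) right_end(1) minimal_collection[OF countable(2) composed]
    by blast
  moreover have "absorption_condition (suborder A) UNIV I
      (suborder (lower_end S S)) (suborder (upper_end S S))"
    using absorption_iff[OF contains_copy_refl countable(2) composed _ countable(1)] points absorbs
    by blast
  then have "absorption_condition (suborder A) UNIV I L R"
    using absorption_condition_cong[OF order_isomorphic_refl left_end(2) right_end(2)] by blast
  then have "admissible_ends UNIV I L R"
    using points by (rule absorption_condition_imp_admissible_ends)
  ultimately show thesis by (rule that)
qed

theorem left_absorbing_iff:
  assumes order: "countable_order X" "X \<noteq> {}"
  shows "left_absorbing X \<longleftrightarrow> (\<exists>N (I :: nat \<Rightarrow> nat rel) (L :: nat rel) (R :: nat rel).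
    shuffle_representation X N I L R \<and> (\<exists>!t. end_condition t N I L R))"
proof -
  have ends: "(\<exists>!t. end_condition t N I L R) \<longleftrightarrow> admissible_ends N I L R"
    if "shuffle_representation X N I L R" for N and I :: "nat \<Rightarrow> nat rel" and L R :: "nat rel"
    using that by (intro end_condition_ex1_iff shuffle_representation_nonempty)
  show ?thesis
  proof
    assume "left_absorbing X"
    then obtain I :: "nat \<Rightarrow> nat rel" and L R :: "nat rel"
      where rep: "shuffle_representation X UNIV I L R" and "admissible_ends UNIV I L R"
      by (rule left_absorbing_representation[OF order])
    then have "\<exists>!t. end_condition t UNIV I L R" using ends by simp
    then show "\<exists>N (I :: nat \<Rightarrow> nat rel) (L :: nat rel) (R :: nat rel).
        shuffle_representation X N I L R \<and> (\<exists>!t. end_condition t N I L R)"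
      using rep by (intro exI conjI)
  qed (use left_absorbing_of_representation[OF order] ends in blast)
qed

section \<open>Absorption for each end type\<close>

lemma order_one_iso_singleton: "\<^bold>1 \<cong> suborder {a}"
  by (rule order_isomorphicI[of "\<lambda>_. a"]) (auto simp: order_one_def Field_def bij_betw_def)

lemma one_rat_one_iso_suborder:
  assumes "countable S" "a \<in> S" "b \<in> S" "a < b" and bounds: "\<And>x. x \<in> S \<Longrightarrow> a \<le> x \<and> x \<le> b"
    and dense: "\<And>x y. x \<in> S \<Longrightarrow> y \<in> S \<Longrightarrow> x < y \<Longrightarrow> \<exists>z\<in>S. x < z \<and> z < y"
  shows "\<^bold>1 \<^bold>+ \<^bold>Q \<^bold>+ \<^bold>1 \<cong> suborder S"
proof -
  let ?B = "S \<inter> {a<..<b}"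
  have "dense_unbounded_in ?B ?B"
    unfolding dense_unbounded_in_def
  proof (intro conjI ballI impI)
    show "?B \<noteq> {}" using dense[OF assms(2-4)] by auto
    fix x assume x_mem: "x \<in> ?B"
    show "\<exists>z\<in>?B. z < x" "\<exists>z\<in>?B. x < z" using dense[of a x] dense[of x b] x_mem assms(2,3) by auto
    fix y assume "y \<in> ?B" "x < y"
    then obtain z where "z \<in> S" "x < z" "z < y" using dense[of x y] x_mem by auto
    then show "\<exists>z\<in>?B. x < z \<and> z < y" using x_mem \<open>y \<in> ?B\<close> by (intro bexI[of _ z]) auto
  qed simp
  then have "\<^bold>Q \<cong> suborder ?B" using assms(1) by (intro order_rat_iso_suborder) simp
  then have "\<^bold>Q \<^bold>+ \<^bold>1 \<cong> suborder ?B \<^bold>+ suborder {b}"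
    using order_one_iso_singleton by (rule order_sum_cong)
  also have "\<dots> \<cong> suborder (?B \<union> {b})" by (rule suborder_Un_iso) (simp add: precedes_def)
  finally have "\<^bold>1 \<^bold>+ \<^bold>Q \<^bold>+ \<^bold>1 \<cong> suborder {a} \<^bold>+ suborder (?B \<union> {b})"
    by (rule order_sum_cong[OF order_one_iso_singleton])
  also have "\<dots> \<cong> suborder ({a} \<union> (?B \<union> {b}))"
    by (rule suborder_Un_iso) (use \<open>a < b\<close> in \<open>auto simp: precedes_def\<close>)
  also have "{a} \<union> (?B \<union> {b}) = S"
    using assms(2,3) bounds by (force simp: order.order_iff_strict)
  finally show ?thesis .
qed

lemma bounded_suborder_without_successors_iso:
  assumes "countable S" and ends: "has_left_endpoint (suborder S)" "has_right_endpoint (suborder S)"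
    and no_succ: "\<And>x y. \<not> is_successor (suborder S) x y"
  shows "\<^bold>1 \<^bold>+ \<^bold>Q \<^bold>+ \<^bold>1 \<cong> suborder S \<or> \<^bold>1 \<cong> suborder S"
proof -
  obtain a b where mem: "a \<in> S" "b \<in> S" and bounds: "\<And>x. x \<in> S \<Longrightarrow> a \<le> x \<and> x \<le> b"
    using ends by (auto simp: has_left_endpoint_def has_right_endpoint_def
        is_left_endpoint_suborder is_right_endpoint_suborder)
  show ?thesis
  proof (cases "a = b")
    case True
    then have "S = {a}" using mem bounds by (force intro: order.antisym)
    then show ?thesis by (simp add: order_one_iso_singleton)
  next
    case False
    then have "a < b" using mem bounds by (simp add: order.strict_iff_order)
    then show ?thesis
      using \<open>countable S\<close> mem bounds no_succ
      by (intro disjI1 one_rat_one_iso_suborder) (auto simp: is_successor_suborder)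
  qed
qed

lemma bounded_without_successors_iff:
  assumes countable: "countable_order A"
  shows "has_left_endpoint A \<and> has_right_endpoint A \<and> \<not> (\<exists>a b. is_successor A a b) \<longleftrightarrow>
    A \<cong> \<^bold>1 \<^bold>+ \<^bold>Q \<^bold>+ \<^bold>1 \<or> A \<cong> \<^bold>1"
proof
  assume bounded: "has_left_endpoint A \<and> has_right_endpoint A \<and> \<not> (\<exists>a b. is_successor A a b)"
  obtain S :: "real set" where real_copy: "countable S" "A \<cong> suborder S"
    using countable by (rule countable_order_iso_real_suborderE)
  have "\<^bold>1 \<^bold>+ \<^bold>Q \<^bold>+ \<^bold>1 \<cong> suborder S \<or> \<^bold>1 \<cong> suborder S"
    using bounded real_copy(1) unfolding endpoint_properties_iso[OF real_copy(2)]
    by (intro bounded_suborder_without_successors_iso) blast+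
  then show "A \<cong> \<^bold>1 \<^bold>+ \<^bold>Q \<^bold>+ \<^bold>1 \<or> A \<cong> \<^bold>1"
    unfolding order_isomorphic_cong[OF real_copy(2) order_isomorphic_refl]
      order_isomorphic_commute[of "suborder S"] .
next
  assume "A \<cong> \<^bold>1 \<^bold>+ \<^bold>Q \<^bold>+ \<^bold>1 \<or> A \<cong> \<^bold>1"
  moreover have "\<^bold>1 \<^bold>+ \<^bold>Q \<^bold>+ \<^bold>1 \<cong> suborder {0..1 :: rat}"
    by (rule one_rat_one_iso_suborder[of _ 0 1])
       (simp_all, meson atLeastAtMost_iff dense less_imp_le order_trans)
  moreover have "\<^bold>1 \<cong> suborder {0..0 :: rat}"
    using order_one_iso_singleton[of "0 :: rat"] by simp
  ultimately have "A \<cong> suborder {0..1 :: rat} \<or> A \<cong> suborder {0..0 :: rat}"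
    using order_isomorphic_trans[of A "\<^bold>1 \<^bold>+ \<^bold>Q \<^bold>+ \<^bold>1"] order_isomorphic_trans[of A "\<^bold>1"] by blast
  then obtain b :: rat where "0 \<le> b" and iso: "A \<cong> suborder {0..b}"
    by (metis order_refl zero_le_one)
  then show "has_left_endpoint A \<and> has_right_endpoint A \<and> \<not> (\<exists>a b. is_successor A a b)"
    unfolding endpoint_properties_iso[OF iso]
    by (simp add: has_endpoints_interval no_successors_interval)
qed

lemma has_endpoint_imp_nonempty: "has_left_endpoint A \<or> has_right_endpoint A \<Longrightarrow> A \<noteq> {}"
  by (auto simp: endpoints_bounded_iff)

lemma absorption_by_end_type:
  assumes order: "countable_order X" "X \<noteq> {}" and rep: "shuffle_representation X N I L R"
    and unique: "\<exists>!t. end_condition t N I L R" and countable: "countable_order A"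
  shows "end_condition C1 N I L R \<Longrightarrow> A \<noteq> {} \<Longrightarrow> A \<^bold>* X \<cong> X"
    and "end_condition C2 N I L R \<Longrightarrow> A \<^bold>* X \<cong> X \<longleftrightarrow> has_left_endpoint A"
    and "end_condition C3 N I L R \<Longrightarrow> A \<^bold>* X \<cong> X \<longleftrightarrow> has_right_endpoint A"
    and "end_condition C4 N I L R \<Longrightarrow> A \<^bold>* X \<cong> X \<longleftrightarrow> A \<cong> \<^bold>1 \<^bold>+ \<^bold>Q \<^bold>+ \<^bold>1 \<or> A \<cong> \<^bold>1"
    and "end_condition C5 N I L R \<Longrightarrow> A \<^bold>* X \<cong> X \<longleftrightarrow> has_left_endpoint A \<and> has_right_endpoint A \<and>
      all_have_successors A \<and> all_have_predecessors A"
    and "end_condition C6 N I L R \<Longrightarrow> A \<^bold>* X \<cong> X \<longleftrightarrow> has_left_endpoint A \<and> has_right_endpoint A \<and>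
      all_have_successors A"
    and "end_condition C7 N I L R \<Longrightarrow> A \<^bold>* X \<cong> X \<longleftrightarrow> has_left_endpoint A \<and> has_right_endpoint A \<and>
      all_have_predecessors A"
    and "end_condition C8 N I L R \<Longrightarrow> A \<^bold>* X \<cong> X \<longleftrightarrow> has_left_endpoint A \<and> has_right_endpoint A"
  using is_block_empty_left_end[OF shuffle_representation_nonempty[OF rep], of L R]
    is_block_empty_right_end[OF shuffle_representation_nonempty[OF rep], of R L]
    has_endpoint_imp_nonempty[of A]
  unfolding absorption_condition_def end_condition_iff_is_block
    absorption_iff_absorption_condition[OF order rep
      shuffle_representation_admissible_ends[OF rep unique] countable]
    bounded_without_successors_iff[OF countable, symmetric]
  by blast+

theorem theorem2:
  fixes X :: "'x rel"
  assumes "countable_order X" and "X \<noteq> {}"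
  shows "(left_absorbing X \<longleftrightarrow>
            (\<exists>N (I :: nat \<Rightarrow> nat rel) (L :: nat rel) (R :: nat rel).
               shuffle_representation X N I L R \<and> (\<exists>!t. end_condition t N I L R)))
       \<and> (\<forall>N (I :: nat \<Rightarrow> 'i rel) (L :: 'l rel) (R :: 'r rel) (A :: 'a rel).
            left_absorbing X \<and> shuffle_representation X N I L R \<and>
            (\<exists>!t. end_condition t N I L R) \<and> countable_order A \<longrightarrow>
              (end_condition C1 N I L R \<longrightarrow> (A \<noteq> {} \<longrightarrow> A \<^bold>* X \<cong> X))
            \<and> (end_condition C2 N I L R \<longrightarrow> (A \<^bold>* X \<cong> X \<longleftrightarrow> has_left_endpoint A))
            \<and> (end_condition C3 N I L R \<longrightarrow> (A \<^bold>* X \<cong> X \<longleftrightarrow> has_right_endpoint A))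
            \<and> (end_condition C4 N I L R \<longrightarrow>
                 (A \<^bold>* X \<cong> X \<longleftrightarrow> A \<cong> \<^bold>1 \<^bold>+ \<^bold>Q \<^bold>+ \<^bold>1 \<or> A \<cong> \<^bold>1))
            \<and> (end_condition C5 N I L R \<longrightarrow>
                 (A \<^bold>* X \<cong> X \<longleftrightarrow> has_left_endpoint A \<and> has_right_endpoint A \<and>
                   all_have_successors A \<and> all_have_predecessors A))
            \<and> (end_condition C6 N I L R \<longrightarrow>
                 (A \<^bold>* X \<cong> X \<longleftrightarrow> has_left_endpoint A \<and> has_right_endpoint A \<and>
                   all_have_successors A))
            \<and> (end_condition C7 N I L R \<longrightarrow>
                 (A \<^bold>* X \<cong> X \<longleftrightarrow> has_left_endpoint A \<and> has_right_endpoint A \<and>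
                   all_have_predecessors A))
            \<and> (end_condition C8 N I L R \<longrightarrow>
                 (A \<^bold>* X \<cong> X \<longleftrightarrow> has_left_endpoint A \<and> has_right_endpoint A)))"
  by (rule conjI[OF left_absorbing_iff[OF assms]], intro allI impI conjI; elim conjE)
    (rule absorption_by_end_type[OF assms]; assumption)+

end
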